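(* Fix an admissible triple $(p_0,q_0,r_0)$ with $q_0\in(1,\infty]$. Then there exists a nondoubling metric measure space $\mathfrak Z$ such that $\mathfrak c(p_0,1,r_0,\mathfrak Z)<\infty$ and $\mathfrak c(p_0,q_0,r_0,\mathfrak Z)=\infty$.
   Context: Metric measure space $(X,\rho,\mu)$: nonempty set, metric, nonnegative Borel measure, every open ball of positive finite measure; doubling means $\mu(B(x,2s))\le C\mu(B(x,s))$ uniformly. Lorentz quasinorm: $d_f(t)=\mu(\{|f|>t\})$, $\|f\|_{p,q}=p^{1/q}(\int_0^\infty(t d_f(t)^{1/p})^q dt/t)^{1/q}$ for $q<\infty$, $\|f\|_{p,\infty}=\sup_{t>0}t d_f(t)^{1/p}$. $\mathcal M^{\rm c}_{\mathfrak X}f(x)=\sup_{s>0}\mu(B(x,s))^{-1}\int_{B(x,s)}|f|d\mu$. $\mathfrak c(p,q,r,\mathfrak X)$ is the smallest $c$ with $\|\mathcal M^{\rm c}_{\mathfrak X}f\|_{p,r}\le c\|f\|_{p,q}$ for all $f\in L^{p,q}(\mathfrak X)$ ($\infty$ if none). A triple $(p,q,r)$ is admissible if either $p=q=1$ and $r\in[1,\infty]$, or $p\in(1,\infty)$ and $q,r\in[1,\infty]$ with $q\le r$. *)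

theory Defs
  imports "HOL-Analysis.Analysis" "HOL-Probability.Probability"
begin

definition mm_space :: "'a set \<Rightarrow> ('a \<Rightarrow> 'a \<Rightarrow> real) \<Rightarrow> 'a measure \<Rightarrow> bool" where
  "mm_space X d M \<longleftrightarrow>
     X \<noteq> {} \<and> Metric_space X d \<and> space M = X \<and>
     sets M = sigma_sets X {U. openin (Metric_space.mtopology X d) U} \<and>
     (\<forall>x\<in>X. \<forall>s>0. 0 < emeasure M (Metric_space.mball X d x s)
                   \<and> emeasure M (Metric_space.mball X d x s) < \<infinity>)"

definition doubling :: "'a set \<Rightarrow> ('a \<Rightarrow> 'a \<Rightarrow> real) \<Rightarrow> 'a measure \<Rightarrow> bool" where
  "doubling X d M \<longleftrightarrow>
     (\<exists>C::real. \<forall>x\<in>X. \<forall>s>0.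
        emeasure M (Metric_space.mball X d x (2 * s)) \<le> ennreal C * emeasure M (Metric_space.mball X d x s))"

text \<open>Real powers of extended nonnegative reals (exponent assumed positive):
  \<infinity> ^ a = \<infinity>, otherwise the usual real power.\<close>
definition epow :: "ennreal \<Rightarrow> real \<Rightarrow> ennreal" where
  "epow x a = (if x = \<infinity> then \<infinity> else ennreal (enn2real x powr a))"

definition outer_emeasure :: "'a measure \<Rightarrow> 'a set \<Rightarrow> ennreal" where
  "outer_emeasure M A = (INF B \<in> {B \<in> sets M. A \<subseteq> B}. emeasure M B)"

definition distrib_fun :: "'a measure \<Rightarrow> ('a \<Rightarrow> ennreal) \<Rightarrow> real \<Rightarrow> ennreal" where
  "distrib_fun M g t = outer_emeasure M {x \<in> space M. g x > ennreal t}"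

definition lorentz_norm :: "'a measure \<Rightarrow> real \<Rightarrow> ennreal \<Rightarrow> ('a \<Rightarrow> ennreal) \<Rightarrow> ennreal" where
  "lorentz_norm M p q g =
     (if q = \<infinity> then (SUP t \<in> {0<..}. ennreal t * epow (distrib_fun M g t) (1 / p))
      else ennreal (p powr (1 / enn2real q)) *
           epow (\<integral>\<^sup>+ t. indicator {0<..} t *
                   (epow (ennreal t * epow (distrib_fun M g t) (1 / p)) (enn2real q) / ennreal t) \<partial>lborel)
                (1 / enn2real q))"

definition centered_maximal ::
    "'a set \<Rightarrow> ('a \<Rightarrow> 'a \<Rightarrow> real) \<Rightarrow> 'a measure \<Rightarrow> ('a \<Rightarrow> real) \<Rightarrow> 'a \<Rightarrow> ennreal" where
  "centered_maximal X d M f x =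
     (SUP s \<in> {0<..}. (\<integral>\<^sup>+ y \<in> Metric_space.mball X d x s. ennreal \<bar>f y\<bar> \<partial>M)
                       / emeasure M (Metric_space.mball X d x s))"

definition lorentz_space :: "'a measure \<Rightarrow> real \<Rightarrow> ennreal \<Rightarrow> ('a \<Rightarrow> real) set" where
  "lorentz_space M p q =
     {f. f \<in> borel_measurable M \<and> lorentz_norm M p q (\<lambda>x. ennreal \<bar>f x\<bar>) < \<infinity>}"

definition max_const ::
    "real \<Rightarrow> ennreal \<Rightarrow> ennreal \<Rightarrow> 'a set \<Rightarrow> ('a \<Rightarrow> 'a \<Rightarrow> real) \<Rightarrow> 'a measure \<Rightarrow> ennreal" where
  "max_const p q r X d M =
     Inf {c. \<forall>f \<in> lorentz_space M p q.
              lorentz_norm M p r (centered_maximal X d M f) \<le> c * lorentz_norm M p q (\<lambda>x. ennreal \<bar>f x\<bar>)}"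

definition admissible :: "real \<Rightarrow> ennreal \<Rightarrow> ennreal \<Rightarrow> bool" where
  "admissible p q r \<longleftrightarrow>
     (p = 1 \<and> q = 1 \<and> 1 \<le> r) \<or> (1 < p \<and> 1 \<le> q \<and> 1 \<le> r \<and> q \<le> r)"

end

theory Submission
  imports Defs "HOL-Library.Discrete_Functions"
begin

text \<open>
  Write \<open>N g = \<integral>\<^bsub>0\<^esub>\<^bsup>\<infinity>\<^esup> \<mu>{g > t}\<^bsup>1/p\<^esup> dt\<close>. The space consists of levels \<open>0, 1, 2, \<dots>\<close>; level \<open>i\<close> has \<open>R i\<close>
  atoms of mass \<open>b i = (R i)\<^bsup>1/(p-1)\<^esup>\<close>, hence total mass \<open>(b i)\<^bsup>p\<^esup>\<close>, and \<open>R\<close> grows so fast that the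
  mass \<open>S i\<close> below level \<open>i\<close> is at most \<open>(b i)\<^bsup>1/p\<^esup>\<close>. The levels are cut into components. In component
  \<open>n\<close> every atom of the last level \<open>leaf n\<close> has exactly one neighbour in each of the other \<open>2n\<close> levels,
  and some ball centred at that atom consists of it and these neighbours.

  \<^item> The function equal to \<open>1 / b i\<close> on the first \<open>2n\<close> levels of component \<open>n\<close> has \<open>L\<^bsup>p,q\<^esup>\<close> quasinorm of order
    \<open>n\<^bsup>1/q\<^esup>\<close>, while its maximal function is at least \<open>n / b (leaf n)\<close> on the last level, so has
    \<open>L\<^bsup>p,r\<^esup>\<close> quasinorm at least of order \<open>n\<close>.

  \<^item> For an indicator of a set whose top level is \<open>i\<close>, the neighbours below level \<open>i\<close> are
    negligible, so only one level is really averaged, and averaging a single level onto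
    the last level is harmless. Since \<open>N\<close> is countably subadditive, this extends from indicators to all functions.
\<close>

section \<open>Lorentz quasinorms\<close>

lemma divide_mono_ennreal:
  fixes a b c d :: ennreal
  assumes "a \<le> b" "c \<le> d"
  shows "a / d \<le> b / c"
proof -
  have "inverse d \<le> inverse c"
  proof (cases "c = 0")
    case False
    with assms(2) show ?thesis
      by (cases c; cases d) (auto simp: inverse_ennreal le_imp_inverse_le top_unique)
  qed simp
  then show ?thesis
    unfolding divide_ennreal_def using assms(1) by (intro mult_mono) auto
qed

lemma ennreal_le_suminf: "f n \<le> suminf f" for f :: "nat \<Rightarrow> ennreal"
  using sum_le_suminf[of f "{n}"] by simp

lemma epow_mono: "x \<le> y \<Longrightarrow> 0 \<le> a \<Longrightarrow> epow x a \<le> epow y a"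
  unfolding epow_def
  by (auto simp: top_unique less_top intro!: ennreal_leI powr_mono2 enn2real_mono)

lemma epow_ennreal: "0 \<le> x \<Longrightarrow> epow (ennreal x) a = ennreal (x powr a)"
  by (simp add: epow_def)

lemma epow_top [simp]: "epow \<infinity> a = \<infinity>" "epow top a = top"
  by (simp_all add: epow_def)

lemma epow_0 [simp]: "epow 0 a = 0"
  by (simp add: epow_def)

lemma epow_one: "epow x 1 = x"
  by (cases x) (auto simp: epow_ennreal)

lemma epow_eq_top_iff [simp]: "epow x a = top \<longleftrightarrow> x = top"
  by (simp add: epow_def)

lemma measurable_epow [measurable]: "(\<lambda>x. epow x a) \<in> borel_measurable borel"
  unfolding epow_def by measurable

lemma borel_measurable_antimono_ennreal:
  fixes f :: "real \<Rightarrow> ennreal"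
  assumes "antimono f"
  shows "f \<in> borel_measurable borel"
proof (rule borel_measurableI_greater)
  fix y
  have "is_interval {x. y < f x}"
    unfolding is_interval_1 using assms by (auto simp: antimono_def intro: less_le_trans)
  then show "{x \<in> space borel. y < f x} \<in> sets borel"
    by (simp add: real_interval_borel_measurable)
qed

lemma outer_emeasure_sets: "A \<in> sets M \<Longrightarrow> outer_emeasure M A = emeasure M A"
  unfolding outer_emeasure_def by (intro antisym INF_lower INF_greatest) (auto intro: emeasure_mono)

lemma outer_emeasure_mono: "A \<subseteq> B \<Longrightarrow> outer_emeasure M A \<le> outer_emeasure M B"
  unfolding outer_emeasure_def by (intro INF_superset_mono) auto

lemma distrib_fun_measurable:
  "g \<in> borel_measurable M \<Longrightarrow> distrib_fun M g t = emeasure M {x \<in> space M. ennreal t < g x}"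
  unfolding distrib_fun_def by (intro outer_emeasure_sets) measurable

lemma distrib_fun_mono:
  "(\<And>x. x \<in> space M \<Longrightarrow> g x \<le> h x) \<Longrightarrow> distrib_fun M g t \<le> distrib_fun M h t"
  unfolding distrib_fun_def by (intro outer_emeasure_mono) (auto intro: less_le_trans)

lemma distrib_fun_antimono: "s \<le> t \<Longrightarrow> distrib_fun M g t \<le> distrib_fun M g s"
  unfolding distrib_fun_def
  by (intro outer_emeasure_mono) (auto intro: le_less_trans[OF ennreal_leI])

lemma borel_measurable_distrib_fun [measurable]: "distrib_fun M g \<in> borel_measurable borel"
  by (intro borel_measurable_antimono_ennreal antimonoI distrib_fun_antimono)

section \<open>The case q = 1 and its comparison with other exponents\<close>

definition lorentz_one :: "'a measure \<Rightarrow> real \<Rightarrow> ('a \<Rightarrow> ennreal) \<Rightarrow> ennreal" where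
  "lorentz_one M p g = (\<integral>\<^sup>+t\<in>{0<..}. epow (distrib_fun M g t) (1 / p) \<partial>lborel)"

lemma lorentz_norm_one:
  assumes "0 < p"
  shows "lorentz_norm M p 1 g = ennreal p * lorentz_one M p g"
proof -
  have "indicator {0<..} t * (ennreal t * y / ennreal t) = y * indicator {0<..} t" for t :: real and y
    by (auto simp: indicator_def ennreal_mult_divide_eq mult.commute[of "ennreal t" y])
  then show ?thesis
    using assms by (simp add: lorentz_norm_def lorentz_one_def epow_one)
qed

text \<open>The distribution function is antimono, so on (0, t] the integrand of
  \<open>lorentz_one\<close> is at least its value at t.\<close>

lemma ennreal_mult_distrib_fun_le_lorentz_one:
  assumes "0 < p" "0 < t"
  shows "ennreal t * epow (distrib_fun M g t) (1 / p) \<le> lorentz_one M p g"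
proof -
  have "ennreal t * epow (distrib_fun M g t) (1 / p)
      = (\<integral>\<^sup>+s. epow (distrib_fun M g t) (1 / p) * indicator {0<..t} s \<partial>lborel)"
    using assms by (subst nn_integral_cmult_indicator) (auto simp: mult.commute)
  also have "\<dots> \<le> lorentz_one M p g"
    unfolding lorentz_one_def using assms
    by (intro nn_integral_mono) (auto simp: indicator_def intro!: epow_mono distrib_fun_antimono)
  finally show ?thesis .
qed

text \<open>The embedding of L^{p,1} into L^{p,r}. It reduces every upper bound on the maximal
  function to the case r = 1.\<close>

lemma lorentz_norm_le_lorentz_one:
  assumes "0 < p" "1 \<le> r"
  shows "\<exists>C>0. \<forall>g. lorentz_norm M p r g \<le> ennreal C * lorentz_one M p g"
proof (cases "r = \<infinity>")
  case True
  show ?thesis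
    using assms(1) by (intro exI[of _ 1])
      (auto simp: lorentz_norm_def True intro!: SUP_least ennreal_mult_distrib_fun_le_lorentz_one)
next
  case False
  define q where "q = enn2real r"
  have q: "1 \<le> q"
    using assms(2) False unfolding q_def by (cases r) (auto simp flip: ennreal_1)
  have bd: "lorentz_norm M p r g \<le> ennreal (p powr (1 / q)) * lorentz_one M p g" for g
  proof (cases "lorentz_one M p g = \<infinity>")
    case True
    then show ?thesis using assms by (simp add: ennreal_mult_top)
  next
    case fin: False
    then obtain N where N: "lorentz_one M p g = ennreal N" "0 \<le> N"
      by (cases "lorentz_one M p g") auto
    \<comment> \<open>Of the q-th power of t times the root of the distribution function, the power
      q - 1 is bounded through the weak-type inequality. The remaining factor cancels 1/t down to
      the integrand of \<open>lorentz_one\<close>.\<close>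
    have "indicator {0<..} t * (epow (ennreal t * epow (distrib_fun M g t) (1 / p)) q / ennreal t)
        \<le> ennreal (N powr (q - 1)) * (epow (distrib_fun M g t) (1 / p) * indicator {0<..} t)" for t
    proof (cases "0 < t")
      case t: True
      have le: "ennreal t * epow (distrib_fun M g t) (1 / p) \<le> ennreal N"
        using ennreal_mult_distrib_fun_le_lorentz_one[OF assms(1) t, of M g] N by simp
      then have "epow (distrib_fun M g t) (1 / p) \<noteq> top"
        using t by (auto simp: ennreal_mult_top top_unique)
      then obtain y where y: "epow (distrib_fun M g t) (1 / p) = ennreal y" "0 \<le> y"
        by (cases "epow (distrib_fun M g t) (1 / p)") auto
      have ty: "t * y \<le> N"
        using le t y N by (simp add: ennreal_mult[symmetric])
      have "(t * y) powr q / t = (t * y) powr (q - 1) * y"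
        using t y by (cases "y = 0") (auto simp: powr_diff)
      also have "\<dots> \<le> N powr (q - 1) * y"
        using ty t y q by (intro mult_right_mono powr_mono2) auto
      finally show ?thesis
        using t y N by (simp add: ennreal_mult[symmetric] epow_ennreal divide_ennreal ennreal_leI)
    qed simp
    then have "(\<integral>\<^sup>+ t. indicator {0<..} t * (epow (ennreal t * epow (distrib_fun M g t) (1 / p)) q / ennreal t) \<partial>lborel)
        \<le> (\<integral>\<^sup>+ t. ennreal (N powr (q - 1)) * (epow (distrib_fun M g t) (1 / p) * indicator {0<..} t) \<partial>lborel)"
      by (intro nn_integral_mono)
    also have "\<dots> = ennreal (N powr (q - 1)) * ennreal N"
      by (subst nn_integral_cmult) (auto simp: N(1)[symmetric] lorentz_one_def)
    also have "\<dots> = ennreal (N powr q)"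
      using N by (cases "N = 0") (auto simp: ennreal_mult[symmetric] powr_diff)
    finally have "epow (\<integral>\<^sup>+ t. indicator {0<..} t * (epow (ennreal t * epow (distrib_fun M g t) (1 / p)) q / ennreal t) \<partial>lborel) (1 / q)
        \<le> epow (ennreal (N powr q)) (1 / q)"
      using q by (intro epow_mono) auto
    also have "\<dots> = ennreal N"
      using q N by (simp add: epow_ennreal powr_powr)
    finally show ?thesis
      using False by (simp add: lorentz_norm_def N q_def mult_left_mono)
  qed
  show ?thesis
    by (intro exI[of _ "p powr (1 / q)"]) (use bd assms in auto)
qed

lemma nn_integral_powr_from_0:
  fixes a q :: real
  assumes "0 < q" "0 \<le> a"
  shows "(\<integral>\<^sup>+t. ennreal (indicator {0..a} t * t powr (q - 1)) \<partial>lborel) = ennreal (a powr q / q)"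
proof (intro nn_integral_has_integral_lborel)
  have ind: "(\<lambda>v. indicator {0..a} v * f v) = (\<lambda>v. if v \<in> {0..a} then f v else 0)" for f :: "real \<Rightarrow> real"
    by (auto simp: indicator_def)
  show "((\<lambda>t. indicator {0..a} t * t powr (q - 1)) has_integral a powr q / q) UNIV"
    unfolding ind has_integral_restrict_UNIV using has_integral_powr_from_0[of "q - 1" a] assms by simp
qed auto

text \<open>Keeping only (0, a) in the integral leaves \<open>B powr q * (a powr q / q)\<close>. The
  constant is chosen before h, a and B because it has to serve a whole sequence of
  functions.\<close>

lemma lorentz_norm_lower:
  assumes "0 < p" "1 \<le> r"
  shows "\<exists>c>0. \<forall>h a B. 0 \<le> a \<longrightarrow> 0 \<le> B \<longrightarrow>
    (\<forall>t. 0 < t \<longrightarrow> t < a \<longrightarrow> ennreal B \<le> epow (distrib_fun M h t) (1 / p)) \<longrightarrow>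
    ennreal (c * (a * B)) \<le> lorentz_norm M p r h"
proof (cases "r = \<infinity>")
  case True
  show ?thesis
  proof (intro exI[of _ "1 / 2"] conjI allI impI)
    fix h :: "'a \<Rightarrow> ennreal" and a B :: real
    assume *: "0 \<le> a" "0 \<le> B" and D: "\<forall>t. 0 < t \<longrightarrow> t < a \<longrightarrow> ennreal B \<le> epow (distrib_fun M h t) (1 / p)"
    show "ennreal (1 / 2 * (a * B)) \<le> lorentz_norm M p r h"
    proof (cases "a = 0")
      case False
      \<comment> \<open>The hypothesis covers only t < a, so the supremum is tested at a /
        2.\<close>
      then have "ennreal (1 / 2 * (a * B)) \<le> ennreal (a / 2) * epow (distrib_fun M h (a / 2)) (1 / p)"
        using * D by (simp add: ennreal_mult[symmetric] mult_left_mono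
            order_trans[OF _ mult_left_mono, of _ "ennreal (a / 2)" "ennreal B"])
      also have "\<dots> \<le> lorentz_norm M p r h"
        using True False * by (auto simp: lorentz_norm_def intro!: SUP_upper)
      finally show ?thesis .
    qed simp
  qed simp
next
  case False
  define q where "q = enn2real r"
  have q: "1 \<le> q"
    using assms(2) False unfolding q_def by (cases r) (auto simp flip: ennreal_1)
  show ?thesis
  proof (intro exI[of _ "p powr (1 / q) * (1 / q) powr (1 / q)"] conjI allI impI)
    fix h :: "'a \<Rightarrow> ennreal" and a B :: real
    assume *: "0 \<le> a" "0 \<le> B" and D: "\<forall>t. 0 < t \<longrightarrow> t < a \<longrightarrow> ennreal B \<le> epow (distrib_fun M h t) (1 / p)"
    let ?I = "\<integral>\<^sup>+ t. indicator {0<..} t * (epow (ennreal t * epow (distrib_fun M h t) (1 / p)) q / ennreal t) \<partial>lborel"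
    have "ennreal (B powr q * (a powr q / q))
        = (\<integral>\<^sup>+ t. ennreal (B powr q) * ennreal (indicator {0..a} t * t powr (q - 1)) \<partial>lborel)"
    proof -
      have "(\<integral>\<^sup>+ t. ennreal (B powr q) * ennreal (indicator {0..a} t * t powr (q - 1)) \<partial>lborel)
          = ennreal (B powr q) * (\<integral>\<^sup>+ t. ennreal (indicator {0..a} t * t powr (q - 1)) \<partial>lborel)"
        by (rule nn_integral_cmult) measurable
      also have "(\<integral>\<^sup>+ t. ennreal (indicator {0..a} t * t powr (q - 1)) \<partial>lborel) = ennreal (a powr q / q)"
        using q * by (intro nn_integral_powr_from_0) auto
      finally show ?thesis using q by (simp only: ennreal_mult[symmetric] powr_ge_zero divide_nonneg_nonneg)
    qed
    also have "\<dots> \<le> ?I"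
    \<comment> \<open>Nothing is assumed at t = a, so the integrands are compared off a null
      set.\<close>
    proof (intro nn_integral_mono_AE AE_I[where N = "{0, a}"])
      have le: "ennreal (B powr q) * ennreal (indicator {0..a} t * t powr (q - 1))
        \<le> indicator {0<..} t * (epow (ennreal t * epow (distrib_fun M h t) (1 / p)) q / ennreal t)"
        if "t \<noteq> 0" "t \<noteq> a" for t
      proof (cases "0 < t \<and> t < a")
        case t: True
        have "B powr q * t powr (q - 1) = (t * B) powr q / t"
          using t * by (simp add: powr_mult powr_diff)
        then have "ennreal (B powr q) * ennreal (indicator {0..a} t * t powr (q - 1)) = epow (ennreal (t * B)) q / ennreal t"
          using t * by (simp add: epow_ennreal divide_ennreal ennreal_mult[symmetric])
        also have "\<dots> \<le> epow (ennreal t * epow (distrib_fun M h t) (1 / p)) q / ennreal t"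
          using D t q * by (intro divide_right_mono_ennreal epow_mono) (auto simp: ennreal_mult intro!: mult_left_mono)
        finally show ?thesis using t by simp
      next
        case False
        then show ?thesis using that by (auto simp: indicator_def)
      qed
      then show "{t \<in> space lborel. \<not> ennreal (B powr q) * ennreal (indicator {0..a} t * t powr (q - 1))
        \<le> indicator {0<..} t * (epow (ennreal t * epow (distrib_fun M h t) (1 / p)) q / ennreal t)} \<subseteq> {0, a}"
        by auto
    qed (auto intro: emeasure_lborel_countable)
    finally have "epow (ennreal (B powr q * (a powr q / q))) (1 / q) \<le> epow ?I (1 / q)"
      using q by (intro epow_mono) auto
    moreover have "epow (ennreal (B powr q * (a powr q / q))) (1 / q) = ennreal ((1 / q) powr (1 / q) * (a * B))"
      using q * by (simp add: epow_ennreal powr_mult powr_divide powr_powr)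
    ultimately have "ennreal (p powr (1 / q)) * ennreal ((1 / q) powr (1 / q) * (a * B))
        \<le> ennreal (p powr (1 / q)) * epow ?I (1 / q)"
      by (simp add: mult_left_mono)
    then show "ennreal (p powr (1 / q) * (1 / q) powr (1 / q) * (a * B)) \<le> lorentz_norm M p r h"
      using False * by (simp add: lorentz_norm_def q_def[symmetric] ennreal_mult[symmetric] mult.assoc)
  qed (use q assms in simp)
qed

lemma lorentz_one_mono:
  "(\<And>x. x \<in> space M \<Longrightarrow> g x \<le> h x) \<Longrightarrow> 0 < p \<Longrightarrow> lorentz_one M p g \<le> lorentz_one M p h"
  unfolding lorentz_one_def
  by (intro nn_integral_mono mult_right_mono epow_mono distrib_fun_mono) auto

lemma lorentz_one_const_indicator:
  assumes "A \<in> sets M" "0 \<le> a" "0 < p"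
  shows "lorentz_one M p (\<lambda>x. ennreal a * indicator A x) = ennreal a * epow (emeasure M A) (1 / p)"
proof -
  have "epow (distrib_fun M (\<lambda>x. ennreal a * indicator A x) t) (1 / p) * indicator {0<..} t
      = epow (emeasure M A) (1 / p) * indicator {0<..<a} t" for t
  proof -
    have *: "{x \<in> space M. ennreal t < ennreal a * indicator A x} = (if t < a then A else {})" if "0 < t"
      using that sets.sets_into_space[OF assms(1)] assms(2)
      by (auto simp: indicator_def ennreal_less_iff split: if_splits)
    then show ?thesis
      using assms(1) by (subst distrib_fun_measurable) (auto simp: * indicator_def[of "{0<..}"] indicator_def[of "{0<..<a}"])
  qed
  then show ?thesis
    using assms by (simp add: lorentz_one_def nn_integral_multc mult.commute)
qed

lemma lorentz_one_cmult:
  assumes "0 < c"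
  shows "lorentz_one M p (\<lambda>x. ennreal c * g x) = ennreal c * lorentz_one M p g"
proof -
  have d: "distrib_fun M (\<lambda>x. ennreal c * g x) (c * t) = distrib_fun M g t" if "0 < t" for t
  proof -
    have "ennreal (c * t) < ennreal c * y \<longleftrightarrow> ennreal t < y" for y
      using assms that by (cases y) (auto simp: ennreal_mult[symmetric] ennreal_less_iff ennreal_mult_top)
    then show ?thesis by (simp add: distrib_fun_def)
  qed
  have "lorentz_one M p (\<lambda>x. ennreal c * g x) =
      ennreal c * (\<integral>\<^sup>+t. epow (distrib_fun M (\<lambda>x. ennreal c * g x) (c * t)) (1 / p) * indicator {0<..} (c * t) \<partial>lborel)"
    unfolding lorentz_one_def
    by (subst nn_integral_real_affine[of _ c 0]) (use assms in auto)
  also have "(\<integral>\<^sup>+t. epow (distrib_fun M (\<lambda>x. ennreal c * g x) (c * t)) (1 / p) * indicator {0<..} (c * t) \<partial>lborel)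
     = lorentz_one M p g"
    unfolding lorentz_one_def using assms d
    by (intro nn_integral_cong) (auto simp: indicator_def zero_less_mult_iff)
  finally show ?thesis .
qed

section \<open>Countable subadditivity for \<open>q = 1\<close>\<close>

lemma emeasure_lborel_greaterThan: "emeasure lborel {l::real<..} = top"
proof (rule ccontr)
  assume "emeasure lborel {l<..} \<noteq> top"
  then obtain r where r: "emeasure lborel {l<..} = ennreal r" "0 \<le> r"
    by (cases "emeasure lborel {l<..}") auto
  have "emeasure lborel {l<..<l + r + 1} \<le> emeasure lborel {l<..}"
    by (intro emeasure_mono) auto
  then show False using r by simp
qed

text \<open>Subtraction truncates at 0, so \<open>h x - ennreal l\<close> is the length of the set
  of t with \<open>l < t\<close> and \<open>ennreal t < h x\<close>; Fubini exchanges x and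
  t.\<close>

lemma layer_cake_truncated:
  assumes "sigma_finite_measure M" and [measurable]: "h \<in> borel_measurable M" and "0 \<le> l"
  shows "(\<integral>\<^sup>+x. h x - ennreal l \<partial>M) = (\<integral>\<^sup>+t\<in>{l<..}. distrib_fun M h t \<partial>lborel)"
proof -
  interpret sigma_finite_measure M by fact
  interpret pair_sigma_finite M lborel ..
  have y: "(\<integral>\<^sup>+t. indicator {t. l < t \<and> ennreal t < y} t \<partial>lborel) = y - ennreal l" for y
  proof (cases y)
    case (real r)
    then have "{t. l < t \<and> ennreal t < y} = {l<..<r}"
      using assms(3) by (auto simp: ennreal_less_iff)
    with real assms(3) show ?thesis
      by (cases "l \<le> r") (auto simp: ennreal_minus ennreal_neg)
  next
    case top
    then have "{t. l < t \<and> ennreal t < y} = {l<..}"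
      by (auto simp: less_top[symmetric])
    with top show ?thesis
      by (simp add: emeasure_lborel_greaterThan)
  qed
  have "(\<integral>\<^sup>+x. h x - ennreal l \<partial>M)
      = (\<integral>\<^sup>+x. (\<integral>\<^sup>+t. indicator {t. l < t \<and> ennreal t < h x} t \<partial>lborel) \<partial>M)"
    by (simp add: y)
  also have "\<dots> = (\<integral>\<^sup>+t. (\<integral>\<^sup>+x. indicator {t. l < t \<and> ennreal t < h x} t \<partial>M) \<partial>lborel)"
    by (rule Fubini'[symmetric]) measurable
  also have "\<dots> = (\<integral>\<^sup>+t\<in>{l<..}. distrib_fun M h t \<partial>lborel)"
  proof (intro nn_integral_cong)
    fix t
    have "(\<integral>\<^sup>+x. indicator {t. l < t \<and> ennreal t < h x} t \<partial>M)
        = (\<integral>\<^sup>+x. indicator {l<..} t * indicator {x \<in> space M. ennreal t < h x} x \<partial>M)"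
      by (intro nn_integral_cong) (auto simp: indicator_def)
    also have "\<dots> = indicator {l<..} t * emeasure M {x \<in> space M. ennreal t < h x}"
      by (rule nn_integral_cmult_indicator) measurable
    finally show "(\<integral>\<^sup>+x. indicator {t. l < t \<and> ennreal t < h x} t \<partial>M) = distrib_fun M h t * indicator {l<..} t"
      by (simp add: distrib_fun_measurable mult.commute)
  qed
  finally show ?thesis .
qed

text \<open>For measurable h and nonzero v this is Peetre's K-functional of the couple (L^1,
  L^\<infinity>): the minimum over truncation heights L of v * L plus the integral of h - L. The
  next two lemmas are the two halves of this.\<close>

definition K_fun :: "'a measure \<Rightarrow> ennreal \<Rightarrow> ('a \<Rightarrow> ennreal) \<Rightarrow> ennreal" where
  "K_fun M v h = (\<integral>\<^sup>+t\<in>{0<..}. min (distrib_fun M h t) v \<partial>lborel)"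

lemma K_fun_upper:
  assumes "sigma_finite_measure M" "h \<in> borel_measurable M" "v \<noteq> 0"
  shows "K_fun M v h \<le> v * L + (\<integral>\<^sup>+x. h x - L \<partial>M)"
proof (cases L)
  case (real l)
  have "K_fun M v h \<le> (\<integral>\<^sup>+t. v * indicator {0<..l} t + distrib_fun M h t * indicator {l<..} t \<partial>lborel)"
    unfolding K_fun_def by (intro nn_integral_mono) (auto simp: indicator_def)
  also have "\<dots> = v * ennreal l + (\<integral>\<^sup>+x. h x - ennreal l \<partial>M)"
    using real assms by (subst nn_integral_add) (auto simp: layer_cake_truncated nn_integral_cmult_indicator)
  finally show ?thesis using real by simp
qed (use assms in \<open>simp add: ennreal_mult_top\<close>)

text \<open>The optimal height is where the distribution function drops to v: below it the minimum
  is v, above it the distribution function. If it never drops to v, then \<open>K_fun\<close> is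
  infinite.\<close>

lemma K_fun_attained:
  assumes "sigma_finite_measure M" "h \<in> borel_measurable M" "v \<noteq> 0"
  shows "\<exists>L. v * L + (\<integral>\<^sup>+x. h x - L \<partial>M) \<le> K_fun M v h"
proof (cases "{t. 0 \<le> t \<and> distrib_fun M h t \<le> v} = {}")
  case True
  then have "min (distrib_fun M h t) v * indicator {0<..} t = v * indicator {0<..} t" for t
    by (auto simp: indicator_def min_def)
  then have "K_fun M v h = top"
    using assms(3) by (simp add: K_fun_def nn_integral_cmult_indicator emeasure_lborel_greaterThan ennreal_mult_top)
  then show ?thesis by simp
next
  case False
  define T where "T = {t. 0 \<le> t \<and> distrib_fun M h t \<le> v}"
  define l where "l = Inf T"
  have T: "T \<noteq> {}" "bdd_below T"
    using False unfolding T_def by (auto intro!: bdd_belowI[of _ 0])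
  have l0: "0 \<le> l"
    unfolding l_def using T by (intro cInf_greatest) (auto simp: T_def)
  have small: "v \<le> distrib_fun M h t" if "0 < t" "t < l" for t
    using cInf_lower[OF _ T(2), of t] that unfolding l_def[symmetric] by (fastforce simp: T_def)
  have large: "distrib_fun M h t \<le> v" if lt: "l < t" for t
  proof -
    obtain s where "s \<in> T" "s < t" using lt T cInf_less_iff[of T t] unfolding l_def by auto
    then show ?thesis using distrib_fun_antimono[of s t M h] by (auto simp: T_def)
  qed
  have "v * ennreal l + (\<integral>\<^sup>+x. h x - ennreal l \<partial>M)
     = (\<integral>\<^sup>+t. v * indicator {0<..<l} t + distrib_fun M h t * indicator {l<..} t \<partial>lborel)"
    using l0 assms by (subst nn_integral_add) (auto simp: layer_cake_truncated nn_integral_cmult_indicator)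
  also have "\<dots> \<le> K_fun M v h"
    unfolding K_fun_def
    using small large l0 by (intro nn_integral_mono) (auto simp: indicator_def min_def)
  finally show ?thesis by blast
qed

text \<open>Termwise, a n is at most (a n - b n) + b n. Finiteness is assumed because
  \<open>top - top = top\<close>.\<close>

lemma ennreal_suminf_diff_le:
  fixes a b :: "nat \<Rightarrow> ennreal"
  assumes "(\<Sum>n. b n) \<noteq> top"
  shows "(\<Sum>n. a n) - (\<Sum>n. b n) \<le> (\<Sum>n. a n - b n)"
proof -
  have "(\<Sum>n. a n) \<le> (\<Sum>n. (a n - b n) + b n)"
  proof (intro suminf_le)
    show "a n \<le> a n - b n + b n" for n
      by (cases "b n \<le> a n") (auto simp: diff_add_cancel_ennreal intro: order_trans[of _ "b n"])
  qed auto

  also have "\<dots> = (\<Sum>n. a n - b n) + (\<Sum>n. b n)"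
    by (rule suminf_add[symmetric]) auto
  finally show ?thesis
    using assms by (simp add: ennreal_minus_le_iff add.commute)
qed

text \<open>Take an optimal truncation height for each summand. The sum of these heights truncates
  the whole sum, and the excess above it is at most the sum of the single excesses.\<close>

lemma K_fun_suminf_le:
  assumes "sigma_finite_measure M" and [measurable]: "\<And>n. h n \<in> borel_measurable M" and "v \<noteq> 0"
  shows "K_fun M v (\<lambda>x. \<Sum>n. h n x) \<le> (\<Sum>n. K_fun M v (h n))"
proof -
  have "\<forall>n. \<exists>L. v * L + (\<integral>\<^sup>+x. h n x - L \<partial>M) \<le> K_fun M v (h n)"
    using assms by (intro allI K_fun_attained)
  then obtain l where l: "\<And>n. v * l n + (\<integral>\<^sup>+x. h n x - l n \<partial>M) \<le> K_fun M v (h n)"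
    by metis
  have "K_fun M v (\<lambda>x. \<Sum>n. h n x) \<le> v * (\<Sum>n. l n) + (\<integral>\<^sup>+x. (\<Sum>n. h n x) - (\<Sum>n. l n) \<partial>M)"
    using assms by (intro K_fun_upper) auto
  also have "\<dots> \<le> v * (\<Sum>n. l n) + (\<integral>\<^sup>+x. (\<Sum>n. h n x - l n) \<partial>M)"
  proof (cases "(\<Sum>n. l n) = top")
    case False
    then show ?thesis by (intro add_left_mono nn_integral_mono ennreal_suminf_diff_le)
  qed (use assms(3) in \<open>simp add: ennreal_mult_top\<close>)
  also have "\<dots> = (\<Sum>n. v * l n + (\<integral>\<^sup>+x. h n x - l n \<partial>M))"
    by (simp add: nn_integral_suminf suminf_add[symmetric])
  also have "\<dots> \<le> (\<Sum>n. K_fun M v (h n))"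
    by (intro suminf_le l) auto
  finally show ?thesis .
qed

text \<open>The power \<open>u\<^bsup>1/p\<^esup>\<close> is a mixture of the concave functions \<open>min u v\<close>; this is
  how the subadditivity of \<open>K_fun\<close> passes to \<open>lorentz_one\<close>.\<close>

lemma nn_integral_min_powr:
  fixes p :: real
  assumes p: "1 < p"
  shows "(\<integral>\<^sup>+v\<in>{0<..}. min u (ennreal v) * ennreal (v powr (1 / p - 2)) \<partial>lborel)
    = ennreal (p + p / (p - 1)) * epow u (1 / p)"
proof -
  let ?Q = "\<lambda>u. \<integral>\<^sup>+v\<in>{0<..}. min u (ennreal v) * ennreal (v powr (1 / p - 2)) \<partial>lborel"
  have pos: "0 < p + p / (p - 1)" using p by (simp add: add_pos_pos)
  have fin: "?Q (ennreal a) = ennreal (p + p / (p - 1)) * epow (ennreal a) (1 / p)" if "0 \<le> a" for a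
  proof (cases "a = 0")
    case True
    have "min 0 (ennreal v) * x * y = 0" for v and x y :: ennreal
      by (simp add: min_def)
    then show ?thesis using True by simp
  next
    case False
    then have a: "0 < a" using that by simp
    \<comment> \<open>The minimum is v up to a and a afterwards. The integrals converge since 1/p -
      1 > -1 at 0 and 1/p - 2 < -1 at \<infinity>.\<close>
    have 1: "((\<lambda>v. v powr (1 / p - 1)) has_integral (a powr (1 / p) * p)) {0..a}"
      using has_integral_powr_from_0[of "1 / p - 1" a] p a by simp
    have 2: "((\<lambda>v. a * v powr (1 / p - 2)) has_integral a * (a powr (1 / p - 1) * (p / (p - 1)))) {a..}"
    proof -
      have "1 / p - 2 < -1" using p by simp
      moreover have "- (a powr (1 / p - 2 + 1)) / (1 / p - 2 + 1) = a powr (1 / p - 1) * (p / (p - 1))"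
        using p by (simp add: divide_simps) (simp add: algebra_simps)
      ultimately show ?thesis
        using has_integral_mult_right[OF has_integral_powr_to_inf[of "1 / p - 2" a], of a] a by simp
    qed
    have ind: "(\<lambda>v. indicator A v * f v) = (\<lambda>v. if v \<in> A then f v else 0)" for A :: "real set" and f :: "real \<Rightarrow> real"
      by (auto simp: indicator_def)
    have I1: "(\<integral>\<^sup>+v. ennreal (indicator {0..a} v * v powr (1 / p - 1)) \<partial>lborel) = ennreal (a powr (1 / p) * p)"
    proof (intro nn_integral_has_integral_lborel)
      show "((\<lambda>v. indicator {0..a} v * v powr (1 / p - 1)) has_integral a powr (1 / p) * p) UNIV"
        unfolding ind has_integral_restrict_UNIV by (rule 1)
    qed auto
    have I2: "(\<integral>\<^sup>+v. ennreal (indicator {a..} v * (a * v powr (1 / p - 2))) \<partial>lborel)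
        = ennreal (a * (a powr (1 / p - 1) * (p / (p - 1))))"
    proof (intro nn_integral_has_integral_lborel)
      show "((\<lambda>v. indicator {a..} v * (a * v powr (1 / p - 2))) has_integral
          a * (a powr (1 / p - 1) * (p / (p - 1)))) UNIV"
        unfolding ind has_integral_restrict_UNIV by (rule 2)
    qed (use a in auto)
    have "?Q (ennreal a) = (\<integral>\<^sup>+v. ennreal (indicator {0..a} v * v powr (1 / p - 1))
        + ennreal (indicator {a..} v * (a * v powr (1 / p - 2))) \<partial>lborel)"
    \<comment> \<open>The two closed ranges overlap in the null set {a}.\<close>
    proof (intro nn_integral_cong_AE AE_I[where N = "{a}"])
      have "v * v powr (1 / p - 2) = v powr (1 / p - 1)" if "0 < v" for v
        using powr_add[of v 1 "1 / p - 2"] that by simp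
      then show "{v \<in> space lborel. min (ennreal a) (ennreal v) * ennreal (v powr (1 / p - 2)) * indicator {0<..} v
          \<noteq> ennreal (indicator {0..a} v * v powr (1 / p - 1)) + ennreal (indicator {a..} v * (a * v powr (1 / p - 2)))} \<subseteq> {a}"
        using a by (auto simp: indicator_def min_def ennreal_mult[symmetric] split: if_splits)
    qed auto
    also have "\<dots> = ennreal (a powr (1 / p) * p) + ennreal (a * (a powr (1 / p - 1) * (p / (p - 1))))"
      by (subst nn_integral_add) (auto simp: I1 I2)
    also have "a * (a powr (1 / p - 1) * (p / (p - 1))) = a powr (1 / p) * (p / (p - 1))"
      using powr_add[of a 1 "1 / p - 1"] a by simp
    finally show ?thesis
      using a p pos by (simp add: epow_ennreal ennreal_mult[symmetric] ennreal_plus[symmetric] algebra_simps del: ennreal_plus)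
  qed
  show ?thesis
  proof (cases u)
    case (real a)
    with fin show ?thesis by simp
  next
    case top
    \<comment> \<open>For infinite u, monotonicity in u bounds the integral below by its values at
      all finite a.\<close>
    have le: "ennreal ((p + p / (p - 1)) * a powr (1 / p)) \<le> ?Q u" if "0 \<le> a" for a
    proof -
      have "?Q (ennreal a) \<le> ?Q u"
        by (intro nn_integral_mono mult_right_mono min.mono) (auto simp: top)
      then show ?thesis using fin[OF that] that p pos by (simp add: epow_ennreal ennreal_mult)
    qed
    have "?Q u = top"
    proof (rule ccontr)
      assume "?Q u \<noteq> top"
      then obtain q where q: "?Q u = ennreal q" "0 \<le> q" by (cases "?Q u") auto
      define c where "c = p + p / (p - 1)"
      \<comment> \<open>The value of a is chosen so that c times its (1/p)-th power is q + c, which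
        exceeds q.\<close>
      have "c * ((q / c + 1) powr p) powr (1 / p) \<le> q"
        using le[of "(q / c + 1) powr p"] q pos unfolding c_def[symmetric] by simp
      moreover have "0 < c" using pos by (simp add: c_def)
      moreover have "((q / c + 1) powr p) powr (1 / p) = q / c + 1"
        using p q \<open>0 < c\<close> by (simp add: powr_powr)
      ultimately show False by (simp add: distrib_left)
    qed
    then show ?thesis using top pos by (simp add: ennreal_mult_top)
  qed
qed

text \<open>Put the distribution function at t for u in the preceding identity, integrate over t and
  exchange the integrals.\<close>

lemma lorentz_one_eq_K_fun:
  assumes "1 < p"
  shows "ennreal (p + p / (p - 1)) * lorentz_one M p h
    = (\<integral>\<^sup>+v\<in>{0<..}. K_fun M (ennreal v) h * ennreal (v powr (1 / p - 2)) \<partial>lborel)"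
proof -
  have "ennreal (p + p / (p - 1)) * lorentz_one M p h = (\<integral>\<^sup>+t.
      ennreal (p + p / (p - 1)) * epow (distrib_fun M h t) (1 / p) * indicator {0<..} t \<partial>lborel)"
    unfolding lorentz_one_def by (subst nn_integral_cmult[symmetric]) (auto simp: mult.assoc)
  also have "\<dots> = (\<integral>\<^sup>+t. (\<integral>\<^sup>+v. min (distrib_fun M h t) (ennreal v) * ennreal (v powr (1 / p - 2))
        * indicator {0<..} v * indicator {0<..} t \<partial>lborel) \<partial>lborel)"
    by (subst nn_integral_min_powr[OF assms, symmetric], subst nn_integral_multc[symmetric]) auto
  also have "\<dots> = (\<integral>\<^sup>+v. (\<integral>\<^sup>+t. min (distrib_fun M h t) (ennreal v) * ennreal (v powr (1 / p - 2))
        * indicator {0<..} v * indicator {0<..} t \<partial>lborel) \<partial>lborel)"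
    by (rule lborel_pair.Fubini') measurable
  also have "\<dots> = (\<integral>\<^sup>+v\<in>{0<..}. K_fun M (ennreal v) h * ennreal (v powr (1 / p - 2)) \<partial>lborel)"
    unfolding K_fun_def
    by (intro nn_integral_cong, simp only: mult.assoc, subst nn_integral_multc[symmetric])
       (auto simp: mult_ac)
  finally show ?thesis .
qed

text \<open>The constant 1 is what allows infinitely many summands. \<open>K_fun\<close> is
  subadditive at each v, and its weighted integral is \<open>lorentz_one\<close> up to a constant
  that cancels.\<close>

lemma lorentz_one_suminf_le:
  assumes "sigma_finite_measure M" "\<And>n. h n \<in> borel_measurable M" "1 < p"
  shows "lorentz_one M p (\<lambda>x. \<Sum>n. h n x) \<le> (\<Sum>n. lorentz_one M p (h n))"
proof -
  let ?c = "ennreal (p + p / (p - 1))"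
  have c: "0 < p + p / (p - 1)" using assms(3) by (simp add: add_pos_pos)
  have "?c * lorentz_one M p (\<lambda>x. \<Sum>n. h n x)
      \<le> (\<integral>\<^sup>+v. (\<Sum>n. K_fun M (ennreal v) (h n) * ennreal (v powr (1 / p - 2)) * indicator {0<..} v) \<partial>lborel)"
    unfolding lorentz_one_eq_K_fun[OF assms(3)] using assms
    by (intro nn_integral_mono)
       (auto simp: indicator_def intro!: mult_right_mono K_fun_suminf_le)
  also have "\<dots> = (\<Sum>n. ?c * lorentz_one M p (h n))"
    unfolding lorentz_one_eq_K_fun[OF assms(3)]
    by (rule nn_integral_suminf) (simp add: K_fun_def)
  also have "\<dots> = ?c * (\<Sum>n. lorentz_one M p (h n))"
    by simp
  finally show ?thesis
    using c by (subst (asm) ennreal_mult_le_mult_iff) auto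
qed

lemma lorentz_one_add_le:
  assumes "sigma_finite_measure M" "g \<in> borel_measurable M" "h \<in> borel_measurable M" "1 < p"
  shows "lorentz_one M p (\<lambda>x. g x + h x) \<le> lorentz_one M p g + lorentz_one M p h"
proof -
  define k where "k n = (if n = 0 then g else if n = Suc 0 then h else (\<lambda>_. 0))" for n :: nat
  have s: "(\<Sum>n. f n) = f 0 + f (Suc 0)" if "\<And>n. n \<ge> 2 \<Longrightarrow> f n = 0" for f :: "nat \<Rightarrow> ennreal"
    using suminf_finite[of "{0, Suc 0}" f] that
    by (auto simp: not_less_eq_eq numeral_2_eq_2 Suc_le_eq)
  have z: "lorentz_one M p (\<lambda>_. 0) = 0"
    by (simp add: lorentz_one_def distrib_fun_measurable)
  have "lorentz_one M p (\<lambda>x. \<Sum>n. k n x) \<le> (\<Sum>n. lorentz_one M p (k n))"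
    using assms by (intro lorentz_one_suminf_le) (auto simp: k_def)
  then show ?thesis
    by (subst (asm) (1 2) s) (auto simp: k_def z)
qed

section \<open>Dyadic level sets and the reduction to indicator functions\<close>

lemma suminf_dyadic_distrib_fun_le:
  assumes "0 < p"
  shows "(\<Sum>n. ennreal (2 powi int_decode n) * epow (distrib_fun M g (2 powi int_decode n)) (1 / p))
    \<le> 2 * lorentz_one M p g"
proof -
  let ?D = "\<lambda>t. epow (distrib_fun M g t) (1 / p)"
  \<comment> \<open>\<open>int_decode\<close> enumerates the integer exponents. Each interval has
    half the length of its right endpoint, so by monotonicity a summand is at most twice the
    integral over its interval, and the intervals are disjoint.\<close>
  define I :: "nat \<Rightarrow> real set" where "I n = {2 powi (int_decode n - 1)<..<2 powi int_decode n}" for n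
  have aux: "I m \<inter> I n = {}" if "int_decode m < int_decode n" for m n
  proof -
    have "(2::real) powi int_decode m \<le> 2 powi (int_decode n - 1)"
      using that by (intro power_int_increasing) auto
    then show ?thesis by (auto simp: I_def)
  qed
  have disj: "disjoint_family I"
    unfolding disjoint_family_on_def
    by (metis aux Int_commute int_decode_eq linorder_neq_iff)
  have half: "2 powi (k - 1) = (2 powi k / 2 :: real)" for k
    by (simp add: power_int_diff)
  have "ennreal (2 powi int_decode n) * ?D (2 powi int_decode n)
      = 2 * (\<integral>\<^sup>+t. ?D (2 powi int_decode n) * indicator (I n) t \<partial>lborel)" for n
  proof -
    have "2 * ennreal (2 powi int_decode n / 2) = ennreal (2 powi int_decode n)"
      by (subst ennreal_numeral[symmetric], subst ennreal_mult[symmetric]) auto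
    then show ?thesis
      by (subst nn_integral_cmult_indicator) (auto simp: I_def half mult.assoc[symmetric] mult.commute[of "epow _ _"])
  qed
  then have "(\<Sum>n. ennreal (2 powi int_decode n) * ?D (2 powi int_decode n))
      = 2 * (\<integral>\<^sup>+t. (\<Sum>n. ?D (2 powi int_decode n) * indicator (I n) t) \<partial>lborel)"
    by (simp add: nn_integral_suminf I_def)
  also have "\<dots> \<le> 2 * (\<integral>\<^sup>+t. (\<Sum>n. ?D t * indicator (I n) t) \<partial>lborel)"
    using assms
    by (intro mult_left_mono nn_integral_mono suminf_le)
       (auto simp: I_def indicator_def intro!: epow_mono distrib_fun_antimono)
  also have "\<dots> = 2 * (\<integral>\<^sup>+t. ?D t * indicator (\<Union>n. I n) t \<partial>lborel)"
    by (simp add: suminf_indicator[OF disj])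
  also have "\<dots> \<le> 2 * lorentz_one M p g"
  proof -
    have "0 < t" if "t \<in> I n" for t n
    proof -
      have "0 < (2::real) powi (int_decode n - 1)" by simp
      also have "\<dots> < t" using that by (simp add: I_def)
      finally show ?thesis .
    qed
    then show ?thesis
      unfolding lorentz_one_def
      by (intro mult_left_mono nn_integral_mono) (auto simp: indicator_def)
  qed
  finally show ?thesis .
qed

text \<open>One summand suffices: the exponent k with 2^k < y \<le> 2^(k+1).\<close>

lemma le_suminf_dyadic:
  fixes y :: real
  assumes "0 \<le> y"
  shows "ennreal y \<le> (\<Sum>n. ennreal (2 * 2 powi int_decode n) * indicator {z. 2 powi int_decode n < z} y)"
proof (cases "y = 0")
  case False
  then have y: "0 < y" using assms by simp
  \<comment> \<open>Ceiling minus 1, unlike the floor, keeps 2^k < y strict when y is a power of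
    2.\<close>
  define k where "k = \<lceil>log 2 y\<rceil> - 1"
  have pw: "(2::real) powi j = 2 powr (of_int j)" for j
    by (simp add: powr_real_of_int')
  have 1: "2 powi k < y"
    unfolding pw using y by (subst less_log_iff[symmetric]) (auto simp: k_def, linarith)
  have "y \<le> 2 powi (k + 1)"
    unfolding pw using y by (subst log_le_iff[symmetric]) (auto simp: k_def)
  then have 2: "y \<le> 2 * 2 powi k" by (simp add: power_int_add)
  let ?f = "\<lambda>n. ennreal (2 * 2 powi int_decode n) * indicator {z. 2 powi int_decode n < z} y"
  have "ennreal y \<le> ?f (int_encode k)"
    using 1 2 by (simp add: ennreal_leI)
  also have "\<dots> \<le> suminf ?f"
    by (rule ennreal_le_suminf)
  finally show ?thesis .
qed simp

text \<open>Level sets reduce the bound on \<open>L\<^bsup>p,1\<^esup>\<close> to indicator functions, because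
  \<open>lorentz_one\<close> is countably subadditive.\<close>

lemma lorentz_one_centered_maximal_le:
  assumes "sigma_finite_measure M" and sM: "sets M = Pow X" and "Metric_space X d" and p: "1 < p" and "0 < C"
    and ind: "\<And>G. G \<subseteq> X \<Longrightarrow> emeasure M G < \<infinity> \<Longrightarrow>
      lorentz_one M p (centered_maximal X d M (indicator G)) \<le> ennreal C * epow (emeasure M G) (1 / p)"
  shows "lorentz_one M p (centered_maximal X d M f) \<le> ennreal (4 * C) * lorentz_one M p (\<lambda>x. ennreal \<bar>f x\<bar>)"
proof (cases "lorentz_one M p (\<lambda>x. ennreal \<bar>f x\<bar>) = \<infinity>")
  case True
  then show ?thesis using \<open>0 < C\<close> by (simp add: ennreal_mult_top)
next
  case False
  interpret Metric_space X d by fact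
  have sp: "space M = X"
    using sets_eq_imp_space_eq[of M "count_space X"] sM by simp
  have meas [measurable]: "h \<in> borel_measurable M" for h :: "_ \<Rightarrow> 'b :: topological_space"
    by (rule measurableI) (auto simp: sM sp)
  define c :: "nat \<Rightarrow> real" where "c n = 2 powi int_decode n" for n
  have c: "0 < c n" for n by (simp add: c_def)
  define F where "F n = {x \<in> X. c n < \<bar>f x\<bar>}" for n
  have dF: "distrib_fun M (\<lambda>x. ennreal \<bar>f x\<bar>) (c n) = emeasure M (F n)" for n
    using c[of n] by (subst distrib_fun_measurable) (auto simp: F_def sp ennreal_less_iff less_imp_le)
  \<comment> \<open>The bound for indicators asks for finite measure, which the weak-type inequality
    supplies.\<close>
  have finF: "emeasure M (F n) < \<infinity>" for n
  proof (rule ccontr)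
    assume "\<not> emeasure M (F n) < \<infinity>"
    then have "ennreal (c n) * epow (distrib_fun M (\<lambda>x. ennreal \<bar>f x\<bar>) (c n)) (1 / p) = \<infinity>"
      using c[of n] by (simp add: dF ennreal_mult_top less_top[symmetric])
    with ennreal_mult_distrib_fun_le_lorentz_one[of p "c n" M "\<lambda>x. ennreal \<bar>f x\<bar>"] p c[of n] False
    show False by (simp add: top_unique)
  qed
  \<comment> \<open>Averages are monotone and countably additive, so the dyadic majorant of |f|
    passes to the maximal function.\<close>
  have "centered_maximal X d M f x \<le> (\<Sum>n. ennreal (2 * c n) * centered_maximal X d M (indicator (F n)) x)" for x
    unfolding centered_maximal_def[of X d M f]
  proof (rule SUP_least)
    fix s :: real assume s: "s \<in> {0<..}"
    let ?B = "mball x s"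
    have "(\<integral>\<^sup>+y\<in>?B. ennreal \<bar>f y\<bar> \<partial>M)
        \<le> (\<integral>\<^sup>+y\<in>?B. (\<Sum>n. ennreal (2 * c n) * ennreal \<bar>indicator (F n) y\<bar>) \<partial>M)"
    proof (intro nn_integral_mono mult_right_mono)
      fix y assume "y \<in> space M"
      then have "indicator {z. 2 powi int_decode n < z} \<bar>f y\<bar> = ennreal \<bar>indicator (F n) y\<bar>" for n
        by (auto simp: F_def c_def sp indicator_def)
      then show "ennreal \<bar>f y\<bar> \<le> (\<Sum>n. ennreal (2 * c n) * ennreal \<bar>indicator (F n) y\<bar>)"
        using le_suminf_dyadic[of "\<bar>f y\<bar>"] by (simp add: c_def)
    qed simp
    also have "\<dots> = (\<Sum>n. ennreal (2 * c n) * (\<integral>\<^sup>+y\<in>?B. ennreal \<bar>indicator (F n) y\<bar> \<partial>M))"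
      by (subst ennreal_suminf_multc[symmetric], subst nn_integral_suminf)
         (auto simp: mult.assoc nn_integral_cmult)
    finally have "(\<integral>\<^sup>+y\<in>?B. ennreal \<bar>f y\<bar> \<partial>M) / emeasure M ?B
        \<le> (\<Sum>n. ennreal (2 * c n) * (\<integral>\<^sup>+y\<in>?B. ennreal \<bar>indicator (F n) y\<bar> \<partial>M)) / emeasure M ?B"
      by (rule divide_right_mono_ennreal)
    also have "\<dots> = (\<Sum>n. ennreal (2 * c n) * ((\<integral>\<^sup>+y\<in>?B. ennreal \<bar>indicator (F n) y\<bar> \<partial>M) / emeasure M ?B))"
      by (simp add: divide_ennreal_def mult.assoc flip: ennreal_suminf_multc)
    also have "\<dots> \<le> (\<Sum>n. ennreal (2 * c n) * centered_maximal X d M (indicator (F n)) x)"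
      unfolding centered_maximal_def using s by (intro suminf_le mult_left_mono SUP_upper) auto
    finally show "(\<integral>\<^sup>+y\<in>?B. ennreal \<bar>f y\<bar> \<partial>M) / emeasure M ?B
      \<le> (\<Sum>n. ennreal (2 * c n) * centered_maximal X d M (indicator (F n)) x)" .
  qed
  then have "lorentz_one M p (centered_maximal X d M f)
      \<le> lorentz_one M p (\<lambda>x. \<Sum>n. ennreal (2 * c n) * centered_maximal X d M (indicator (F n)) x)"
    using p by (intro lorentz_one_mono) auto
  also have "\<dots> \<le> (\<Sum>n. lorentz_one M p (\<lambda>x. ennreal (2 * c n) * centered_maximal X d M (indicator (F n)) x))"
    using assms by (intro lorentz_one_suminf_le) auto
  also have "\<dots> = (\<Sum>n. ennreal (2 * c n) * lorentz_one M p (centered_maximal X d M (indicator (F n))))"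
    using c by (simp add: lorentz_one_cmult)
  also have "\<dots> \<le> (\<Sum>n. ennreal (2 * c n) * (ennreal C * epow (emeasure M (F n)) (1 / p)))"
    by (intro suminf_le mult_left_mono ind finF) (auto simp: F_def)
  also have "\<dots> = (\<Sum>n. ennreal (2 * C) * (ennreal (c n) * epow (distrib_fun M (\<lambda>x. ennreal \<bar>f x\<bar>) (c n)) (1 / p)))"
    using c \<open>0 < C\<close> by (simp add: dF ennreal_mult less_imp_le mult_ac)
  \<comment> \<open>One factor 2 is from the dyadic majorant, the other from the dyadic sum.\<close>
  also have "\<dots> \<le> ennreal (2 * C) * (2 * lorentz_one M p (\<lambda>x. ennreal \<bar>f x\<bar>))"
    using suminf_dyadic_distrib_fun_le[of p M "\<lambda>x. ennreal \<bar>f x\<bar>"] p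
    by (simp add: c_def mult_left_mono)
  also have "\<dots> = ennreal (4 * C) * lorentz_one M p (\<lambda>x. ennreal \<bar>f x\<bar>)"
  proof -
    have "ennreal (2 * C) * 2 = ennreal (4 * C)"
      using \<open>0 < C\<close> by (subst ennreal_numeral[symmetric], subst ennreal_mult[symmetric]) auto
    then show ?thesis by (simp add: mult.assoc[symmetric])
  qed
  finally show ?thesis .
qed

section \<open>The space\<close>

text \<open>\<open>pt i a\<close> codes the \<open>a\<close>-th atom of level \<open>i\<close> as a real number; component \<open>n\<close> consists of the
  levels from \<open>n\<^sup>2\<close> to \<open>leaf n = (n + 1)\<^sup>2 - 1\<close>.\<close>

definition pt :: "nat \<Rightarrow> nat \<Rightarrow> real" where "pt i a = real (prod_encode (i, a))"
definition lv :: "real \<Rightarrow> nat" where "lv x = fst (prod_decode (nat \<lfloor>x\<rfloor>))"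
definition ix :: "real \<Rightarrow> nat" where "ix x = snd (prod_decode (nat \<lfloor>x\<rfloor>))"

lemma lv_pt [simp]: "lv (pt i a) = i" and ix_pt [simp]: "ix (pt i a) = a"
  by (simp_all add: pt_def lv_def ix_def)

definition cmp :: "real \<Rightarrow> nat" where "cmp x = floor_sqrt (lv x)"
definition leaf :: "nat \<Rightarrow> nat" where "leaf n = n * n + 2 * n"

lemma floor_sqrt_le_iff_leaf: "floor_sqrt i \<le> n \<longleftrightarrow> i \<le> leaf n"
  using le_floor_sqrt_iff[of "Suc n" i] by (auto simp: leaf_def power2_eq_square)

lemma floor_sqrt_leaf [simp]: "floor_sqrt (leaf n) = n"
  by (rule floor_sqrt_unique) (auto simp: leaf_def power2_eq_square)

lemma le_leaf_floor_sqrt: "i \<le> leaf (floor_sqrt i)"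
  by (simp flip: floor_sqrt_le_iff_leaf)

section \<open>Sizes and masses of the levels\<close>

locale tower =
  fixes p :: real and c :: nat
  assumes p: "1 < p" and c: "2 * p\<^sup>2 \<le> real c"
begin

text \<open>Powers of 2, so that the sizes divide one another; the double exponential gives the
  growth in \<open>S_le\<close>. The exponent in \<open>b\<close> is the one for which
  \<open>K i powr (1 / p) = b i\<close>.\<close>

definition R :: "nat \<Rightarrow> nat" where "R i = 2 ^ (c ^ Suc i)"
definition b :: "nat \<Rightarrow> real" where "b i = real (R i) powr (1 / (p - 1))"
definition K :: "nat \<Rightarrow> real" where "K i = real (R i) * b i"
definition S :: "nat \<Rightarrow> real" where "S i = (\<Sum>j<i. K j)"

lemma c_ge: "2 \<le> c"
proof -
  have "1 < p\<^sup>2" using p by (simp add: one_less_power)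
  with c have "2 < real c" by linarith
  then show ?thesis by linarith
qed

lemma R_pos [simp]: "0 < R i"
  by (simp add: R_def)

lemma R_dvd: "i \<le> j \<Longrightarrow> R i dvd R j"
  unfolding R_def using c_ge by (intro le_imp_power_dvd power_increasing) auto

text \<open>Later lets the reciprocals of the sizes be summed by a geometric series.\<close>

lemma two_power_R_le: "2 ^ j * R i \<le> R (i + j)"
proof (induction j)
  case (Suc j)
  have "c ^ Suc (i + j) + 1 \<le> c ^ Suc (i + j) * 2"
    using c_ge by (auto simp: Suc_le_eq)
  also have "\<dots> \<le> c ^ Suc (i + Suc j)"
    using c_ge by simp
  finally have "2 * R (i + j) \<le> R (i + Suc j)"
    unfolding R_def power_Suc[of 2, symmetric] by (intro power_increasing) auto
  with Suc show ?case by simp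
qed simp

lemma b_ge_1: "1 \<le> b i"
  unfolding b_def using p by (intro ge_one_powr_ge_zero) (auto simp: Suc_le_eq)

lemma b_pos [simp]: "0 < b i"
  using b_ge_1[of i] by linarith

lemma R_eq: "real (R i) = b i powr (p - 1)"
  unfolding b_def using p by (simp add: powr_powr)

lemma b_nonneg [simp]: "0 \<le> b i"
  using b_ge_1[of i] by linarith

lemma K_eq: "K i = b i powr p"
  using powr_add[of "b i" "p - 1" 1] by (simp add: K_def R_eq)

lemma K_ge_b: "b i \<le> K i"
  using R_pos[of i] unfolding K_def by (simp add: Suc_le_eq[symmetric] del: R_pos)

lemma K_pos [simp]: "0 < K i"
  by (simp add: K_def)

lemma K_root: "K i powr (1 / p) = b i"
  using p by (simp add: K_eq powr_powr)

lemma S_nonneg [simp]: "0 \<le> S i"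
  unfolding S_def by (intro sum_nonneg less_imp_le) simp

lemma S_Suc: "S (Suc i) = S i + K i"
  by (simp add: S_def)

lemma S_mono: "i \<le> j \<Longrightarrow> S i \<le> S j"
  unfolding S_def by (intro sum_mono2) (auto simp: less_imp_le)

text \<open>In the induction step \<open>S (Suc i)\<close> is at most \<open>2 * b i powr p\<close>.
  Written as powers of 2, the claim becomes \<open>p - 1 + p * E \<le> c * E / p\<close>, which
  follows from \<open>2 * p\<^sup>2 \<le> real c\<close> and E \<ge> 1.\<close>

lemma S_le: "S i \<le> b i powr (1 / p)"
proof (induction i)
  case (Suc i)
  define E where "E = real (c ^ Suc i)"
  have b2: "b j = 2 powr (real (c ^ Suc j) / (p - 1))" for j
    unfolding b_def R_def by (simp add: powr_realpow[symmetric] powr_powr)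
  have "b i powr (1 / p) \<le> b i powr p"
    using p b_ge_1[of i] by (intro powr_mono) (auto simp: field_simps intro: order_trans[of _ p])
  then have "S (Suc i) \<le> 2 * b i powr p"
    using Suc by (simp add: S_Suc K_eq)
  also have "\<dots> = 2 powr (1 + p * E / (p - 1))"
    by (simp add: b2 powr_powr powr_add E_def mult.commute)
  also have "\<dots> \<le> 2 powr (c * E / (p - 1) / p)"
  proof (intro powr_mono)
    have "c ^ 1 \<le> c ^ Suc i" using c_ge by (intro power_increasing) auto
    then have "1 \<le> E" using c_ge by (simp add: E_def del: power_Suc)
    then have "p\<^sup>2 * 1 + p\<^sup>2 * E \<le> 2 * p\<^sup>2 * E"
      using p by (simp add: mult_left_mono)
    also have "\<dots> \<le> c * E"
      using c \<open>1 \<le> E\<close> by (intro mult_right_mono) auto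
    finally have "(p - 1 + p * E) * p \<le> c * E"
      using p by (simp add: algebra_simps power2_eq_square)
    then have "p - 1 + p * E \<le> c * E / p"
      using p by (simp add: pos_le_divide_eq)
    then have "(p - 1 + p * E) / (p - 1) \<le> c * E / p / (p - 1)"
      using p by (intro divide_right_mono) auto
    then show "1 + p * E / (p - 1) \<le> c * E / (p - 1) / p"
      using p by (simp add: add_divide_distrib mult.commute)
  qed simp
  also have "\<dots> = b (Suc i) powr (1 / p)"
    by (simp add: b2 powr_powr E_def)
  finally show ?case .
qed (simp add: S_def)

lemma S_le_b: "S i \<le> b i"
proof -
  have "b i powr (1 / p) \<le> b i powr 1"
    using p b_ge_1[of i] by (intro powr_mono) auto
  with S_le[of i] show ?thesis by simp
qed

text \<open>A bound on the mass of a set thus bounds the levels it meets, so a nonempty set of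
  finite measure has a top level.\<close>

lemma of_nat_le_b: "real i \<le> b i"
proof -
  have "real i \<le> S i"
  proof (induction i)
    case (Suc i)
    then show ?case using K_ge_b[of i] b_ge_1[of i] by (simp add: S_Suc)
  qed simp
  with S_le_b[of i] show ?thesis by linarith
qed

lemma nonzero [simp]: "R i \<noteq> 0" "b i \<noteq> 0" "K i \<noteq> 0"
  using R_pos[of i] b_pos[of i] K_pos[of i] by (auto simp del: R_pos b_pos K_pos)

section \<open>The metric measure space\<close>

definition X :: "real set" where "X = {x \<in> range real. ix x < R (lv x)}"

definition L :: "nat \<Rightarrow> real set" where "L i = {x \<in> X. lv x = i}"

text \<open>Reducing the index gives an atom of the last level exactly one neighbour in X on each
  lower level of its component; by \<open>R_dvd\<close> the last level is spread evenly over each of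
  these.\<close>

definition parent :: "real \<Rightarrow> real \<Rightarrow> bool" where
  "parent x y \<longleftrightarrow> lv x = leaf (cmp x) \<and> lv y < lv x \<and> cmp y = cmp x \<and> ix y = ix x mod R (lv y)"

definition nbr :: "real \<Rightarrow> real set" where
  "nbr x = {y \<in> X. parent x y \<or> parent y x}"

text \<open>Within a component neighbours are at half the distance of other distinct pairs, which
  secures the triangle inequality. The scaling by the component makes large balls swallow whole
  components.\<close>

definition d :: "real \<Rightarrow> real \<Rightarrow> real" where
  "d x y = (if x = y then 0 else
     real (1 + max (cmp x) (cmp y)) * (if parent x y \<or> parent y x then 1 else 2))"

definition M :: "real measure" where
  "M = point_measure X (\<lambda>x. ennreal (b (lv x)))"

lemma pt_in_X [simp]: "pt i a \<in> X \<longleftrightarrow> a < R i"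
  by (auto simp: X_def) (simp add: pt_def)

lemma X_pt: "x \<in> X \<Longrightarrow> pt (lv x) (ix x) = x"
  by (auto simp: X_def lv_def ix_def pt_def)

lemma L_eq: "L i = pt i ` {..<R i}"
proof
  show "L i \<subseteq> pt i ` {..<R i}"
    using X_pt by (force simp: L_def X_def)
qed (auto simp: L_def)

lemma card_L: "card (L i) = R i"
  unfolding L_eq by (subst card_image) (auto simp: inj_on_def pt_def)

lemma finite_L [simp]: "finite (L i)"
  by (simp add: L_eq)

lemma L_subset [simp]: "L i \<subseteq> X"
  by (auto simp: L_def)

lemma space_M [simp]: "space M = X" and sets_M [simp]: "sets M = Pow X"
  by (simp_all add: M_def space_point_measure sets_point_measure)

lemma emeasure_finite: "finite A \<Longrightarrow> A \<subseteq> X \<Longrightarrow> emeasure M A = ennreal (\<Sum>x\<in>A. b (lv x))"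
  unfolding M_def by (subst emeasure_point_measure_finite2) (auto simp: sum_ennreal less_imp_le)

lemma emeasure_subset_L: "A \<subseteq> L i \<Longrightarrow> emeasure M A = ennreal (real (card A) * b i)"
proof -
  assume A: "A \<subseteq> L i"
  then have "emeasure M A = ennreal (\<Sum>x\<in>A. b (lv x))"
    by (intro emeasure_finite) (auto simp: L_def intro: finite_subset[OF _ finite_L[of i, unfolded L_def]])
  also have "(\<Sum>x\<in>A. b (lv x)) = (\<Sum>x\<in>A. b i)"
    using A by (intro sum.cong) (auto simp: L_def)
  finally show ?thesis by simp
qed

lemma emeasure_L: "emeasure M (L i) = ennreal (K i)"
  by (subst emeasure_subset_L[of _ i]) (simp_all add: card_L K_def)

lemma emeasure_singleton: "x \<in> X \<Longrightarrow> emeasure M {x} = ennreal (b (lv x))"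
  by (simp add: emeasure_finite)

lemma below_Suc: "{x \<in> X. lv x < Suc i} = {x \<in> X. lv x < i} \<union> L i"
  by (auto simp: L_def)

lemma finite_below: "finite {x \<in> X. lv x < i}"
proof (induction i)
  case (Suc i)
  then show ?case unfolding below_Suc by simp
qed simp

lemma emeasure_below: "emeasure M {x \<in> X. lv x < i} = ennreal (S i)"
proof (induction i)
  case (Suc i)
  have "emeasure M {x \<in> X. lv x < Suc i} = emeasure M {x \<in> X. lv x < i} + emeasure M (L i)"
    unfolding below_Suc by (intro plus_emeasure[symmetric]) (auto simp: L_def)
  then show ?case
    by (simp add: Suc emeasure_L S_Suc ennreal_plus less_imp_le)
qed (simp add: S_def)

lemma measurable_M [measurable]: "h \<in> borel_measurable M" for h :: "real \<Rightarrow> 'b :: topological_space"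
  by (rule measurableI) auto

lemma sigma_finite_M: "sigma_finite_measure M"
proof
  show "\<exists>A. countable A \<and> A \<subseteq> sets M \<and> \<Union>A = space M \<and> (\<forall>a\<in>A. emeasure M a \<noteq> \<infinity>)"
    by (intro exI[of _ "range L"]) (auto simp: emeasure_L, auto simp: L_def)
qed

lemma parent_cmp: "parent x y \<Longrightarrow> cmp y = cmp x"
  by (simp add: parent_def)

lemma Metric_space_d: "Metric_space X d"
proof
  show "0 \<le> d x y" for x y by (simp add: d_def)
  show "d x y = d y x" for x y by (auto simp: d_def max.commute)
  show "d x y = 0 \<longleftrightarrow> x = y" for x y by (auto simp: d_def)
  show "d x z \<le> d x y + d y z" for x y z
  proof (cases "x = y \<or> y = z \<or> x = z")
    case False
    let ?r = "\<lambda>x y. parent x y \<or> parent y x"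
    have r: "?r u v \<Longrightarrow> cmp u = cmp v" for u v by (auto dest: parent_cmp)
    \<comment> \<open>Two neighbour steps, which stay in one component, already add up to this
      largest possible distance; a path with a non-neighbour step is at least as long.\<close>
    have le: "d x z \<le> 2 + 2 * real (max (cmp x) (cmp z))"
      by (auto simp: d_def)
    have d: "d u v = (if ?r u v then 1 + real (cmp u) else 2 + 2 * real (max (cmp u) (cmp v)))" if "u \<noteq> v" for u v
      using that r[of u v] by (auto simp: d_def)
    show ?thesis
      using le d[of x y] d[of y z] False r[of x y] r[of y z] by (auto split: if_splits)
  qed (auto simp: d_def)
qed

lemmas mspace_simps = Metric_space.in_mball[OF Metric_space_d]

definition B :: "nat \<Rightarrow> real set" where "B l = {x \<in> X. cmp x \<le> l}"

lemma B_eq: "B l = {x \<in> X. lv x < Suc (leaf l)}"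
  by (auto simp: B_def cmp_def floor_sqrt_le_iff_leaf)

lemma d_nbr: "y \<in> nbr x \<Longrightarrow> y \<noteq> x \<Longrightarrow> d x y = 1 + real (cmp x)"
  by (auto simp: d_def nbr_def dest: parent_cmp)

lemma d_not_nbr:
  "y \<notin> nbr x \<Longrightarrow> y \<in> X \<Longrightarrow> y \<noteq> x \<Longrightarrow> d x y = 2 + 2 * real (max (cmp x) (cmp y))"
  by (auto simp: d_def nbr_def)

lemma d_self: "d x x = 0"
  by (simp add: d_def)

text \<open>With n the component of x, neighbours are at distance 1 + n and the remaining points at
  2 + 2n or more, which the open ball just excludes.\<close>

lemma mball_nbr:
  assumes "x \<in> X"
  shows "Metric_space.mball X d x (2 + 2 * real (cmp x)) = insert x (nbr x)"
proof -
  have "y \<in> X \<and> d x y < 2 + 2 * real (cmp x) \<longleftrightarrow> y = x \<or> y \<in> nbr x" for y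
  proof -
    consider "y = x" | "y \<noteq> x" "y \<in> nbr x" "y \<in> X" | "y \<noteq> x" "y \<notin> nbr x" "y \<in> X" | "y \<notin> X" "y \<notin> nbr x"
      by (auto simp: nbr_def)
    then show ?thesis
    proof cases
      case 1
      then show ?thesis using d_self[of x] assms by simp
    next
      case 2
      then show ?thesis using d_nbr[of y x] by simp
    next
      case 3
      then have "d x y \<ge> 2 + 2 * real (cmp x)" using d_not_nbr[of y x] by simp
      with 3 show ?thesis by simp
    qed (use assms in auto)
  qed
  then show ?thesis unfolding set_eq_iff insert_iff mspace_simps using assms by blast
qed

text \<open>The three shapes belong to radii up to 1 + n, up to 2 + 2n, and beyond, where n is the
  component of x.\<close>

lemma mball_cases:
  assumes x: "x \<in> X" and s: "0 < s"
  shows "Metric_space.mball X d x s = {x} \<or> Metric_space.mball X d x s = insert x (nbr x)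
    \<or> (\<exists>l\<ge>cmp x. Metric_space.mball X d x s = B l)"
proof -
  define k where "k = cmp x"
  have mem: "y \<in> Metric_space.mball X d x s \<longleftrightarrow> y \<in> X \<and> d x y < s" for y
    using x by (auto simp: mspace_simps)
  note nb = d_nbr[of _ x, folded k_def] and nnb = d_not_nbr[of _ x, folded k_def]
  note xx = d_self[of x]
  consider "s \<le> 1 + real k" | "1 + real k < s" "s \<le> 2 + 2 * real k" | "2 + 2 * real k < s" by linarith
  then show ?thesis
  proof cases
    case 1
    have "y \<in> X \<and> d x y < s \<longleftrightarrow> y = x" for y
      using nb[of y] nnb[of y] xx 1 s x by (cases "y = x"; cases "y \<in> nbr x") auto
    then show ?thesis by (auto simp: mem set_eq_iff)
  next
    case 2
    have "y \<in> X \<and> d x y < s \<longleftrightarrow> y = x \<or> y \<in> nbr x" for y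
      using nb[of y] nnb[of y] xx 2 s x by (cases "y = x"; cases "y \<in> nbr x") (auto simp: nbr_def)
    then show ?thesis by (auto simp: mem set_eq_iff)
  next
    case 3
    \<comment> \<open>The largest natural number with 2 + 2l < s; the ceiling minus 1 accounts for
      the strict inequality.\<close>
    define l where "l = nat (\<lceil>s / 2 - 1\<rceil> - 1)"
    have l: "2 + 2 * real a < s \<longleftrightarrow> a \<le> l" for a :: nat
      using 3 unfolding l_def by linarith
    have kl: "k \<le> l" using 3 l by simp
    have "y \<in> X \<and> d x y < s \<longleftrightarrow> y \<in> X \<and> cmp y \<le> l" for y
    proof (cases "y = x \<or> y \<notin> X")
      case True
      then show ?thesis using xx s kl by (auto simp: k_def)
    next
      case y: False
      show ?thesis
      proof (cases "y \<in> nbr x")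
        case True
        then have "cmp y = k" by (auto simp: nbr_def k_def dest: parent_cmp)
        then show ?thesis using nb[OF True] 3 y kl by auto
      next
        case False
        then show ?thesis using nnb[OF False] y l[of "max k (cmp y)"] kl by auto
      qed
    qed
    then show ?thesis using kl by (auto simp: mem set_eq_iff B_def k_def)
  qed
qed

lemma mball_one: "x \<in> X \<Longrightarrow> Metric_space.mball X d x 1 = {x}"
  by (auto simp: mspace_simps d_def split: if_splits)

lemma finite_B [simp]: "finite (B l)"
  unfolding B_eq by (rule finite_below)

lemma nbr_subset_B: "nbr x \<subseteq> B (cmp x)"
  by (auto simp: nbr_def B_def dest: parent_cmp)

lemma mm_space_tower: "mm_space X d M"
proof -
  interpret Metric_space X d by (rule Metric_space_d)
  \<comment> \<open>Unit balls are singletons, so the topology is discrete and every subset is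
    Borel.\<close>
  have "openin mtopology U" if "U \<subseteq> X" for U
    unfolding openin_mtopology using that mball_one by (auto intro!: exI[of _ 1])
  then have "{U. openin mtopology U} = Pow X"
    using openin_subset[of mtopology] by auto
  moreover have "0 < emeasure M (mball x s) \<and> emeasure M (mball x s) < \<infinity>" if "x \<in> X" "0 < s" for x s
  proof
    have xin: "x \<in> mball x s" using that by simp
    have "0 < emeasure M {x}" using that by (simp add: emeasure_singleton)
    also have "\<dots> \<le> emeasure M (mball x s)" using xin by (intro emeasure_mono) auto
    finally show "0 < emeasure M (mball x s)" .
    have "finite (mball x s)"
      using mball_cases[OF that] finite_subset[OF nbr_subset_B] by auto
    then show "emeasure M (mball x s) < \<infinity>"
      by (simp add: emeasure_finite mball_subset_mspace)
  qed
  moreover have "X \<noteq> {}" using pt_in_X[of 0 0] by (auto simp del: pt_in_X simp: R_pos)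
  ultimately show ?thesis
    unfolding mm_space_def using Metric_space_d by (auto simp: sigma_sets_top sigma_algebra.sigma_sets_eq[OF sigma_algebra_Pow])
qed

text \<open>Centre the balls at an atom of the first level i = n^2 of component n. At radius 1 + n
  only the centre is inside; at twice that radius there is an atom of the last level, of mass at
  least \<open>K i = R i * b i\<close>. The ratio is at least \<open>R i\<close>, which is
  unbounded.\<close>

lemma not_doubling_tower: "\<not> doubling X d M"
proof
  assume "doubling X d M"
  then obtain C where C: "\<And>x s. x \<in> X \<Longrightarrow> 0 < s \<Longrightarrow>
      emeasure M (Metric_space.mball X d x (2 * s)) \<le> ennreal C * emeasure M (Metric_space.mball X d x s)"
    unfolding doubling_def by blast
  \<comment> \<open>For n \<ge> 1 the first level lies strictly below \<open>leaf n\<close>.\<close>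
  have "real (R i) \<le> C" if "i = n * n" "n \<ge> 1" for i n
  proof -
    let ?x = "pt i 0" and ?y = "pt (leaf n) 0"
    have cx: "cmp ?x = n" using that by (simp add: cmp_def power2_eq_square[symmetric])
    have cy: "cmp ?y = n" by (simp add: cmp_def)
    have par: "parent ?y ?x"
      using cx cy that unfolding parent_def by (auto simp: leaf_def)
    have ne: "?x \<noteq> ?y" using that by (auto simp: pt_def leaf_def)
    have sub: "Metric_space.mball X d ?x (1 + real n) \<subseteq> {?x}"
      using cx by (auto simp: mspace_simps d_def split: if_splits)
    have yin: "?y \<in> Metric_space.mball X d ?x (2 * (1 + real n))"
      using par ne cx cy by (auto simp: mspace_simps d_def)
    have "ennreal (K i) \<le> ennreal (b (leaf n))"
    proof (intro ennreal_leI)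
      have "S (Suc i) \<le> S (leaf n)" using that by (intro S_mono) (simp add: leaf_def)
      then show "K i \<le> b (leaf n)"
        using S_le_b[of "leaf n"] S_nonneg[of i] unfolding S_Suc by linarith
    qed
    also have "\<dots> = emeasure M {?y}" by (simp add: emeasure_singleton)
    also have "\<dots> \<le> emeasure M (Metric_space.mball X d ?x (2 * (1 + real n)))"
      using yin by (intro emeasure_mono) (auto simp: mspace_simps)
    also have "\<dots> \<le> ennreal C * emeasure M (Metric_space.mball X d ?x (1 + real n))"
      by (intro C) auto
    also have "\<dots> \<le> ennreal C * emeasure M {?x}"
      using sub by (intro mult_left_mono emeasure_mono) auto
    \<comment> \<open>\<open>ennreal\<close> sends a negative C to 0.\<close>
    also have "\<dots> = ennreal (max 0 C * b i)"
      by (cases "0 \<le> C") (auto simp: emeasure_singleton ennreal_mult' ennreal_neg)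
    finally have "K i \<le> max 0 C * b i"
      by (subst (asm) ennreal_le_iff) auto
    then have "real (R i) \<le> max 0 C"
      unfolding K_def by (simp add: mult_le_cancel_right)
    moreover have "0 < real (R i)" by simp
    ultimately show ?thesis by linarith
  qed
  moreover have "real n \<le> real (R (n * n))" for n
  proof -
    have "n < 2 ^ n" by (rule less_exp)
    also have "\<dots> \<le> 2 ^ (n * n) * R 0" by (auto intro!: order_trans[OF power_increasing[of n "n * n" 2]] simp: Suc_le_eq)
    also have "\<dots> \<le> R (n * n)" using two_power_R_le[of "n * n" 0] by simp
    finally show ?thesis by simp
  qed
  ultimately have "real n \<le> C" if "n \<ge> 1" for n
    using that order_trans by blast
  then show False
    using reals_Archimedean2[of "max 1 C"] by (metis less_le_not_le max.bounded_iff nle_le not_le of_nat_1 of_nat_le_iff)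
qed

section \<open>The bound for indicator functions\<close>

lemma nn_integral_indicator_set:
  "(\<integral>\<^sup>+y\<in>A. ennreal \<bar>indicator G y\<bar> \<partial>M) = emeasure M (G \<inter> A)" if "A \<subseteq> X"
proof -
  have "(\<integral>\<^sup>+y\<in>A. ennreal \<bar>indicator G y\<bar> \<partial>M) = (\<integral>\<^sup>+y. indicator (G \<inter> A) y \<partial>M)"
    by (intro nn_integral_cong) (auto simp: indicator_def)
  also have "\<dots> = emeasure M (G \<inter> A)" using that by (subst nn_integral_indicator) auto
  finally show ?thesis .
qed

text \<open>The set \<open>G\<close> has top level \<open>i\<close>, and \<open>k\<close> is the component of that level. Every level
  below \<open>i\<close> is so light compared with one atom of level \<open>i\<close> that the trivial bound 1 suffices there.\<close>

lemma centered_maximal_indicator_le: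
  fixes G i
  defines "k \<equiv> floor_sqrt i"
  assumes G: "G \<subseteq> {x \<in> X. lv x \<le> i}" and x: "x \<in> X"
  shows "centered_maximal X d M (indicator G) x \<le> indicator (G \<union> {x \<in> X. lv x < i}) x
    + ennreal (S i / b (leaf k)) * indicator (L (leaf k)) x
    + ennreal (b i / b (leaf k)) * indicator {x \<in> L (leaf k). pt i (ix x mod R i) \<in> G} x
    + (\<Sum>l. (if k \<le> l then emeasure M G / ennreal (K (leaf l)) else 0) * indicator (B l) x)"
    (is "_ \<le> ?a + ?b + ?c + ?d")
  unfolding centered_maximal_def
proof (rule SUP_least)
  have split: "u \<le> u + v + w + z" "v + w \<le> u + v + w + z" "z \<le> u + v + w + z" for u v w z :: ennreal
    using add_increasing[of u "v + w" "v + w"] add_increasing2[of "v + w" u u] add_increasing2[of z "u + v + w"]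
      add_increasing[of "u + v + w" z z]
    by (auto simp: add.assoc intro: order_trans)
  fix s :: real assume "s \<in> {0<..}"
  then have s: "0 < s" by simp
  define A where "A = Metric_space.mball X d x s"
  have A: "A \<subseteq> X" "x \<in> A"
    using x s by (auto simp: A_def mspace_simps d_def)
  have posA: "emeasure M A \<noteq> 0" "emeasure M A \<noteq> top"
  proof -
    have "0 < emeasure M A \<and> emeasure M A < \<infinity>"
      using mm_space_tower x s unfolding mm_space_def A_def by blast
    then show "emeasure M A \<noteq> 0" "emeasure M A \<noteq> top" by auto
  qed
  \<comment> \<open>The terms stand, in order, for the trivial bound 1, the neighbours below level
    i, the one neighbour on level i, and the large balls \<open>B l\<close>.\<close>
  have "emeasure M (G \<inter> A) / emeasure M A \<le> ?a + ?b + ?c + ?d"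
  proof (cases "x \<in> G \<or> lv x < i")
    case True
    have "emeasure M (G \<inter> A) / emeasure M A \<le> 1"
      using posA A by (intro divide_le_posI_ennreal) (auto intro!: emeasure_mono simp: zero_less_iff_neq_zero)
    also have "1 \<le> ?a" using True x by (auto simp: indicator_def)
    finally show ?thesis using split(1) by (rule order_trans)
  next
    case False
    then have xG: "x \<notin> G" and xi: "i \<le> lv x" by auto
    have kx: "k \<le> cmp x" using xi unfolding k_def cmp_def by (rule mono_floor_sqrt')
    consider "A = {x}" | "A = insert x (nbr x)" | l where "cmp x \<le> l" "A = B l"
      using mball_cases[OF x s] unfolding A_def by blast
    then show ?thesis
    proof cases
      case 1
      then show ?thesis using xG by simp
    next
      case 2
      show ?thesis
      proof (cases "G \<inter> nbr x = {}")
        case True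
        then show ?thesis using 2 xG by simp
      next
        case False
        then obtain y where y: "y \<in> G" "y \<in> nbr x" by blast
        have yi: "lv y \<le> i" using y G by auto
        \<comment> \<open>Level i bounds y from above and x from below, so x is the one on the last
          level.\<close>
        have par: "parent x y"
          using y(2) yi xi unfolding nbr_def parent_def by auto
        have cx: "cmp x = k"
        proof -
          have "cmp x = cmp y" using par by (simp add: parent_def)
          also have "\<dots> \<le> k" using yi unfolding k_def cmp_def by (rule mono_floor_sqrt')
          finally show ?thesis using kx by simp
        qed
        have lx: "lv x = leaf k" using par cx by (simp add: parent_def)
        then have xL: "x \<in> L (leaf k)" using x by (simp add: L_def)
        let ?q = "pt i (ix x mod R i)"
        \<comment> \<open>Neighbours of x below it are determined by their level, so on level i only
          \<open>?q\<close> can occur.\<close>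
        have "G \<inter> A \<subseteq> {x \<in> X. lv x < i} \<union> (if ?q \<in> G then {?q} else {})"
        proof
          fix z assume z: "z \<in> G \<inter> A"
          then have zi: "lv z \<le> i" "z \<in> X" using G by auto
          have "z \<in> nbr x" using z xG 2 by auto
          then have pz: "parent x z" using zi xi unfolding nbr_def parent_def by auto
          show "z \<in> {x \<in> X. lv x < i} \<union> (if ?q \<in> G then {?q} else {})"
          proof (cases "lv z < i")
            case False
            then have "lv z = i" using zi by simp
            then have "z = ?q" using pz X_pt[OF zi(2)] by (simp add: parent_def)
            then show ?thesis using z by auto
          qed (use zi in auto)
        qed
        then have "emeasure M (G \<inter> A) \<le> emeasure M ({x \<in> X. lv x < i} \<union> (if ?q \<in> G then {?q} else {}))"
          by (intro emeasure_mono) auto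
        also have "\<dots> \<le> ennreal (S i) + ennreal (b i) * indicator {x \<in> L (leaf k). ?q \<in> G} x"
          using xL by (intro order_trans[OF emeasure_subadditive])
            (auto simp: emeasure_below emeasure_singleton)
        finally have num: "emeasure M (G \<inter> A) \<le> \<dots>" .
        have "ennreal (b (leaf k)) = emeasure M {x}"
          using x lx by (simp add: emeasure_singleton)
        also have "\<dots> \<le> emeasure M A"
          using A by (intro emeasure_mono) auto
        finally have den: "ennreal (b (leaf k)) \<le> emeasure M A" .
        have "emeasure M (G \<inter> A) / emeasure M A
            \<le> (ennreal (S i) + ennreal (b i) * indicator {x \<in> L (leaf k). ?q \<in> G} x) / ennreal (b (leaf k))"
          using num den by (intro divide_mono_ennreal) auto
        also have "\<dots> = ?b + ?c"
          using xL by (auto simp: add_divide_distrib_ennreal divide_ennreal indicator_def)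
        finally show ?thesis using split(2) by (rule order_trans)
      qed
    next
      case (3 l)
      then have kl: "k \<le> l" using kx by simp
      let ?f = "\<lambda>l. (if k \<le> l then emeasure M G / ennreal (K (leaf l)) else 0) * indicator (B l) x"
      \<comment> \<open>\<open>B l\<close> contains the whole last level of component l.\<close>
      have "ennreal (K (leaf l)) = emeasure M (L (leaf l))" by (simp add: emeasure_L)
      also have "\<dots> \<le> emeasure M A"
        unfolding 3 B_eq by (intro emeasure_mono) (auto simp: L_def)
      finally have "emeasure M (G \<inter> A) / emeasure M A \<le> emeasure M G / ennreal (K (leaf l))"
        using G by (intro divide_mono_ennreal emeasure_mono) auto
      also have "\<dots> = ?f l"
        using 3 kl x by (simp add: B_def)
      also have "\<dots> \<le> ?d"
        by (rule ennreal_le_suminf)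
      finally show ?thesis using split(3) by (rule order_trans)
    qed
  qed
  then show "(\<integral>\<^sup>+y\<in>Metric_space.mball X d x s. ennreal \<bar>indicator G y\<bar> \<partial>M)
      / emeasure M (Metric_space.mball X d x s) \<le> ?a + ?b + ?c + ?d"
    unfolding A_def[symmetric] nn_integral_indicator_set[OF A(1)] .
qed

text \<open>Each residue modulo \<open>R i\<close> is taken by \<open>R j div R i\<close> indices on
  level j; the atom masses turn this ratio into \<open>K j / K i\<close>.\<close>

lemma emeasure_leaf_over:
  assumes "i \<le> j" "G \<subseteq> X"
  shows "emeasure M {x \<in> L j. pt i (ix x mod R i) \<in> G} \<le> emeasure M (G \<inter> L i) * ennreal (K j / K i)"
proof -
  obtain q where q: "R j = R i * q" using R_dvd[OF assms(1)] by (elim dvdE)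
  define H where "H = {a. a < R i \<and> pt i a \<in> G}"
  have HG: "card H = card (G \<inter> L i)"
  proof -
    have "G \<inter> L i = pt i ` H" unfolding L_eq H_def by auto
    then show ?thesis by (simp add: card_image inj_on_def pt_def)
  qed
  have fH: "finite H" by (simp add: H_def)
  have "{x \<in> L j. pt i (ix x mod R i) \<in> G} \<subseteq> (\<lambda>(a, m). pt j (a + R i * m)) ` (H \<times> {..<q})"
  proof
    fix x assume x: "x \<in> {x \<in> L j. pt i (ix x mod R i) \<in> G}"
    then obtain a where a: "x = pt j a" "a < R j" by (auto simp: L_eq)
    have "a mod R i \<in> H" using x a by (simp add: H_def)
    moreover have "a div R i < q" using a q by (simp add: less_mult_imp_div_less mult.commute)
    ultimately show "x \<in> (\<lambda>(a, m). pt j (a + R i * m)) ` (H \<times> {..<q})"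
      using a by (intro image_eqI[of _ _ "(a mod R i, a div R i)"]) auto
  qed
  then have "card {x \<in> L j. pt i (ix x mod R i) \<in> G} \<le> card (H \<times> {..<q})"
    using fH by (intro surj_card_le[of _ _ "\<lambda>(a, m). pt j (a + R i * m)"]) auto
  then have "real (card {x \<in> L j. pt i (ix x mod R i) \<in> G}) * b j \<le> real (card (G \<inter> L i) * q) * b j"
    by (intro mult_right_mono) (auto simp: card_cartesian_product HG simp del: of_nat_mult)
  also have "\<dots> = (real (card (G \<inter> L i)) * b i) * (K j / K i)"
    unfolding K_def q by (simp add: field_simps)
  finally show ?thesis
    using emeasure_subset_L[of "{x \<in> L j. pt i (ix x mod R i) \<in> G}" j] emeasure_subset_L[of "G \<inter> L i" i]
    by (simp add: ennreal_mult[symmetric] less_imp_le ennreal_leI)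
qed

text \<open>The four terms of the pointwise bound contribute 2, 1, 1 and 8 times the (1/p)-th power
  of the measure of G, hence 12.\<close>

lemma lorentz_one_centered_maximal_indicator_le:
  assumes GX: "G \<subseteq> X" and fin: "emeasure M G < \<infinity>"
  shows "lorentz_one M p (centered_maximal X d M (indicator G)) \<le> ennreal 12 * epow (emeasure M G) (1 / p)"
proof (cases "G = {}")
  case True
  then have "centered_maximal X d M (indicator G) = (\<lambda>x. 0)"
    by (auto simp: centered_maximal_def)
  then show ?thesis by (simp add: lorentz_one_def distrib_fun_measurable)
next
  case False
  obtain g where g: "emeasure M G = ennreal g" "0 \<le> g"
    using fin by (cases "emeasure M G") auto
  have bg: "b (lv x) \<le> g" if "x \<in> G" for x
  proof -
    have "emeasure M {x} \<le> emeasure M G" using that GX by (intro emeasure_mono) auto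
    then show ?thesis using that GX g by (auto simp: emeasure_singleton)
  qed
  have "finite (lv ` G)"
  proof (rule finite_subset)
    have "lv x \<le> nat \<lceil>g\<rceil>" if "x \<in> G" for x
      using of_nat_le_b[of "lv x"] bg[OF that] by linarith
    then show "lv ` G \<subseteq> {..nat \<lceil>g\<rceil>}" by auto
  qed simp
  define i where "i = Max (lv ` G)"
  have iG: "i \<in> lv ` G" and le_i: "\<And>x. x \<in> G \<Longrightarrow> lv x \<le> i"
    unfolding i_def using \<open>finite (lv ` G)\<close> False by auto
  define k where "k = floor_sqrt i"
  define J where "J = leaf k"
  have iJ: "i \<le> J" unfolding J_def k_def by (rule le_leaf_floor_sqrt)
  \<comment> \<open>G contains an atom of its top level.\<close>
  have big: "b i \<le> g" using bg iG by auto
  have g0: "0 < g" using big b_pos[of i] by linarith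
  let ?a = "\<lambda>x. indicator (G \<union> {x \<in> X. lv x < i}) x :: ennreal"
  let ?b = "\<lambda>x. ennreal (S i / b J) * indicator (L J) x"
  let ?c = "\<lambda>x. ennreal (b i / b J) * indicator {x \<in> L J. pt i (ix x mod R i) \<in> G} x"
  let ?e = "\<lambda>l x. ennreal (if k \<le> l then g / K (leaf l) else 0) * indicator (B l) x"
  let ?d = "\<lambda>x. \<Sum>l. ?e l x"
  let ?N = "lorentz_one M p"
  define h where "h = g powr (1 / p)"
  have h: "0 < h" using g0 by (simp add: h_def)
  have ph: "0 \<le> 1 / p" using p by simp
  have two: "(2::real) powr (1 / p) \<le> 2" using powr_mono[of "1 / p" 1 "2::real"] p by simp
  note sf = sigma_finite_M
  have "centered_maximal X d M (indicator G) x \<le> ?a x + ?b x + ?c x + ?d x" if "x \<in> X" for x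
  proof -
    have "(if k \<le> l then emeasure M G / ennreal (K (leaf l)) else 0)
      = ennreal (if k \<le> l then g / K (leaf l) else 0)" for l
      using g by (simp add: divide_ennreal)
    with centered_maximal_indicator_le[of G i x] GX le_i that show ?thesis
      by (auto simp: k_def J_def)
  qed
  then have "?N (centered_maximal X d M (indicator G)) \<le> ?N (\<lambda>x. ?a x + ?b x + ?c x + ?d x)"
    using p by (intro lorentz_one_mono) auto
  also have "\<dots> \<le> ?N ?a + ?N ?b + ?N ?c + ?N ?d"
    using sf p by (intro order_trans[OF lorentz_one_add_le] add_mono order_refl) auto
  also have "\<dots> \<le> ennreal (2 * h) + ennreal h + ennreal h + ennreal (8 * h)"
  proof (intro add_mono)
    \<comment> \<open>The levels below i have mass at most \<open>b i\<close>, so adding them at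
      most doubles g.\<close>
    have "?N ?a = epow (emeasure M (G \<union> {x \<in> X. lv x < i})) (1 / p)"
      using lorentz_one_const_indicator[of "G \<union> {x \<in> X. lv x < i}" M 1 p] p GX by simp
    also have "\<dots> \<le> epow (ennreal (2 * g)) (1 / p)"
    proof (rule epow_mono[OF _ ph])
      have "emeasure M (G \<union> {x \<in> X. lv x < i}) \<le> ennreal g + ennreal (S i)"
        using GX by (intro order_trans[OF emeasure_subadditive]) (auto simp: g emeasure_below)
      also have "\<dots> \<le> ennreal (2 * g)"
        using S_le_b[of i] big g by (simp add: ennreal_plus[symmetric] ennreal_leI del: ennreal_plus)
      finally show "emeasure M (G \<union> {x \<in> X. lv x < i}) \<le> ennreal (2 * g)" .
    qed
    also have "\<dots> \<le> ennreal (2 * h)"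
      using g two h by (simp add: epow_ennreal powr_mult h_def[symmetric] mult_right_mono ennreal_leI)
    finally show "?N ?a \<le> ennreal (2 * h)" .
  next
    have "?N ?b = ennreal (S i / b J) * epow (ennreal (K J)) (1 / p)"
      using p by (subst lorentz_one_const_indicator) (auto simp: emeasure_L)
    also have "\<dots> = ennreal (S i)"
      by (simp add: epow_ennreal less_imp_le K_root ennreal_mult[symmetric])
    \<comment> \<open>Here the full strength of \<open>S_le\<close> is used: \<open>S i\<close> has
      to be compared with the (1/p)-th power of g.\<close>
    also have "S i \<le> h"
      using S_le[of i] big powr_mono2[OF ph _ big] b_nonneg[of i] unfolding h_def by linarith
    finally show "?N ?b \<le> ennreal h" by (simp add: ennreal_leI)
  next
    \<comment> \<open>Pulling a set back from level i to level J multiplies its measure by at most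
      \<open>K J / K i\<close>, whose (1/p)-th power \<open>b J / b i\<close> cancels the
      height.\<close>
    have "?N ?c = ennreal (b i / b J) * epow (emeasure M {x \<in> L J. pt i (ix x mod R i) \<in> G}) (1 / p)"
      using p by (subst lorentz_one_const_indicator) (auto simp: L_def)
    also have "\<dots> \<le> ennreal (b i / b J) * epow (ennreal (g * (K J / K i))) (1 / p)"
    proof (intro mult_left_mono epow_mono[OF _ ph])
      have "emeasure M {x \<in> L J. pt i (ix x mod R i) \<in> G} \<le> emeasure M (G \<inter> L i) * ennreal (K J / K i)"
        by (rule emeasure_leaf_over[OF iJ GX])
      also have "\<dots> \<le> ennreal g * ennreal (K J / K i)"
        using GX by (intro mult_right_mono) (auto simp: g(1)[symmetric] intro!: emeasure_mono)
      finally show "emeasure M {x \<in> L J. pt i (ix x mod R i) \<in> G} \<le> ennreal (g * (K J / K i))"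
        using g by (subst ennreal_mult) (auto simp: less_imp_le)
    qed simp
    also have "\<dots> = ennreal h"
      using g by (simp add: epow_ennreal less_imp_le powr_mult powr_divide K_root h_def ennreal_mult[symmetric])
    finally show "?N ?c \<le> ennreal h" .
  next
    \<comment> \<open>With j = \<open>leaf l\<close>, the set \<open>B l\<close> has mass at most
      \<open>2 * K j\<close>, and \<open>b j / K j\<close> is 1 / \<open>R j\<close>.\<close>
    have N_e: "?N (?e l) \<le> ennreal (if k \<le> l then 2 * g / real (R (leaf l)) else 0)" for l
    proof -
      define j where "j = leaf l"
      have "?N (?e l) = ennreal (if k \<le> l then g / K j else 0) * epow (emeasure M (B l)) (1 / p)"
        using p g less_imp_le[OF K_pos[of j]] unfolding j_def
        by (subst lorentz_one_const_indicator) (auto simp: B_def)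
      also have "emeasure M (B l) = ennreal (S (Suc j))"
        unfolding B_eq j_def by (rule emeasure_below)
      also have "epow (ennreal (S (Suc j))) (1 / p) \<le> epow (ennreal (2 * K j)) (1 / p)"
        using S_le_b[of j] K_ge_b[of j] by (intro epow_mono ph ennreal_leI) (simp add: S_Suc)
      also have "\<dots> \<le> ennreal (2 * b j)"
        using two by (simp add: epow_ennreal less_imp_le powr_mult K_root mult_right_mono ennreal_leI)
      also have "ennreal (if k \<le> l then g / K j else 0) * ennreal (2 * b j)
          = ennreal (if k \<le> l then 2 * g / real (R j) else 0)"
        using g b_pos[of j] by (auto simp: ennreal_mult[symmetric] less_imp_le K_def simp del: b_pos)
      finally show ?thesis by (auto simp: j_def mult_left_mono)
    qed
    have "?N ?d \<le> (\<Sum>l. ?N (?e l))"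
      using sf p by (intro lorentz_one_suminf_le) auto
    also have "\<dots> \<le> (\<Sum>l. ennreal (if k \<le> l then 2 * g / real (R (leaf l)) else 0))"
      by (intro suminf_le N_e) auto
    also have "\<dots> = (\<Sum>l. ennreal (2 * g / real (R (leaf (l + k)))))"
      by (subst suminf_offset[of _ k]) auto
    also have "\<dots> \<le> (\<Sum>l. ennreal (2 * g / real (R J) * (1 / 2) ^ l))"
    proof (intro suminf_le ennreal_leI)
      fix l
      obtain m where m: "leaf (l + k) = J + m" "l \<le> m"
      proof -
        have "l + J \<le> leaf (l + k)"
          by (induction l) (auto simp: J_def leaf_def)
        then show ?thesis using that[of "leaf (l + k) - J"] by simp
      qed
      have "(2::nat) ^ l * R J \<le> 2 ^ m * R J" using m by (intro mult_right_mono power_increasing) auto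
      also have "\<dots> \<le> R (leaf (l + k))" unfolding m by (rule two_power_R_le)
      finally have le: "2 ^ l * real (R J) \<le> real (R (leaf (l + k)))"
        by (metis of_nat_le_iff of_nat_mult of_nat_numeral of_nat_power)
      have "2 * g / real (R (leaf (l + k))) \<le> 2 * g / (2 ^ l * real (R J))"
        using le g by (intro divide_left_mono) (auto intro!: mult_pos_pos)
      then show "2 * g / real (R (leaf (l + k))) \<le> 2 * g / real (R J) * (1 / 2) ^ l"
        by (simp add: power_divide mult.commute)
    qed auto
    also have "\<dots> = ennreal (2 * g / real (R J) * 2)"
    proof (rule suminf_ennreal_eq)
      show "(\<lambda>l. 2 * g / real (R J) * (1 / 2) ^ l) sums (2 * g / real (R J) * 2)"
        using sums_mult[OF geometric_sums[of "1 / 2 :: real"], of "2 * g / real (R J)"] by simp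
    qed (use g in auto)
    also have "\<dots> \<le> ennreal (8 * h)"
    proof (rule ennreal_leI)
      \<comment> \<open>G lies on levels up to J. Taking the power 1 - 1/p bounds that power of g by
        \<open>2 * R J\<close>, which turns g / \<open>R J\<close> into at most 2h.\<close>
      have "g \<le> 2 * K J"
      proof -
        have "ennreal g \<le> emeasure M {x \<in> X. lv x < Suc i}"
          unfolding g(1)[symmetric] using GX le_i by (intro emeasure_mono) (auto simp: less_Suc_eq_le)
        then have "g \<le> S (Suc i)" by (simp add: emeasure_below)
        also have "\<dots> \<le> S (Suc J)" using iJ by (intro S_mono) simp
        also have "\<dots> \<le> 2 * K J" using S_le_b[of J] K_ge_b[of J] by (simp add: S_Suc)
        finally show ?thesis .
      qed
      then have "g powr (1 - 1 / p) \<le> (2 * K J) powr (1 - 1 / p)"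
        using p g by (intro powr_mono2) auto
      also have "\<dots> = 2 powr (1 - 1 / p) * K J powr (1 - 1 / p)"
        by (simp add: powr_mult less_imp_le)
      also have "K J powr (1 - 1 / p) = real (R J)"
        using p by (simp add: K_eq R_eq powr_powr right_diff_distrib)
      also have "2 powr (1 - 1 / p) * real (R J) \<le> 2 * real (R J)"
        using powr_mono[of "1 - 1 / p" 1 "2::real"] p by (intro mult_right_mono) auto
      finally have "g powr (1 - 1 / p) * h \<le> 2 * real (R J) * h"
        using h by (intro mult_right_mono) auto
      moreover have "g powr (1 - 1 / p) * h = g"
        using g0 by (simp add: h_def powr_add[symmetric])
      ultimately show "2 * g / real (R J) * 2 \<le> 8 * h"
        by (simp add: divide_le_eq mult.commute mult.left_commute)
    qed
    finally show "?N ?d \<le> ennreal (8 * h)" .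
  qed
  also have "\<dots> = ennreal 12 * epow (emeasure M G) (1 / p)"
  proof -
    have "ennreal (2 * h) + ennreal h + ennreal h + ennreal (8 * h) = ennreal (12 * h)"
      using h by (simp add: ennreal_plus[symmetric] del: ennreal_plus)
    also have "\<dots> = ennreal 12 * ennreal h"
      using h by (intro ennreal_mult) auto
    finally show ?thesis using g by (simp only: epow_ennreal h_def)
  qed
  finally show ?thesis .
qed

section \<open>Finiteness of the constant for q = 1\<close>

lemma max_const_finite:
  assumes "1 \<le> r"
  shows "max_const p 1 r X d M < \<infinity>"
proof -
  obtain C where C: "0 < C" "\<And>g. lorentz_norm M p r g \<le> ennreal C * lorentz_one M p g"
    using lorentz_norm_le_lorentz_one[of p r M] p assms by auto
  have "lorentz_norm M p r (centered_maximal X d M f)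
      \<le> ennreal (C * 48) * lorentz_norm M p 1 (\<lambda>x. ennreal \<bar>f x\<bar>)" for f
  proof -
    let ?n = "lorentz_one M p (\<lambda>x. ennreal \<bar>f x\<bar>)"
    \<comment> \<open>12 is from indicators, 4 from the passage to general functions, C from the
      embedding.\<close>
    have "lorentz_norm M p r (centered_maximal X d M f) \<le> ennreal C * (ennreal (4 * 12) * ?n)"
      by (intro order_trans[OF C(2)] mult_left_mono lorentz_one_centered_maximal_le
          sigma_finite_M Metric_space_d p lorentz_one_centered_maximal_indicator_le) auto
    also have "\<dots> = ennreal (C * 48) * ?n"
      using C by (simp add: ennreal_mult mult.assoc)
    also have "\<dots> \<le> ennreal (C * 48) * (ennreal p * ?n)"
      using p mult_right_mono[of 1 "ennreal p" ?n] by (intro mult_left_mono) auto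
    finally show ?thesis
      using p by (simp add: lorentz_norm_one)
  qed
  then have "max_const p 1 r X d M \<le> ennreal (C * 48)"
    unfolding max_const_def by (intro Inf_lower) auto
  then show ?thesis by (simp add: le_less_trans)
qed

section \<open>Unboundedness for \<open>q > 1\<close>\<close>

text \<open>The height \<open>1 / b j\<close> times \<open>K j powr (1 / p)\<close> is 1, so the
  levels carry equal weight.\<close>

definition test_fun :: "nat \<Rightarrow> real \<Rightarrow> real" where
  "test_fun n x = (if x \<in> X \<and> n * n \<le> lv x \<and> lv x < leaf n then 1 / b (lv x) else 0)"

text \<open>Masses grow so fast that a superlevel set is controlled by its top level j: everything
  up to j has mass at most \<open>2 * K j\<close>.\<close>

lemma test_fun_distrib:
  fixes n t
  defines "D \<equiv> epow (distrib_fun M (\<lambda>x. ennreal \<bar>test_fun n x\<bar>) t) (1 / p)"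
  assumes "0 < t"
  shows "D = 0 \<or> (\<exists>j\<in>{n * n..<leaf n}. t < 1 / b j \<and> D \<le> ennreal (2 * b j))"
proof -
  define E where "E = {x \<in> X. t < test_fun n x}"
  have "{x \<in> space M. ennreal t < ennreal \<bar>test_fun n x\<bar>} = E"
    using assms(2) by (auto simp: E_def test_fun_def ennreal_less_iff less_imp_le)
  then have D: "D = epow (emeasure M E) (1 / p)"
    by (simp add: D_def distrib_fun_measurable)
  show ?thesis
  proof (cases "E = {}")
    case False
    have E: "lv x \<in> {n * n..<leaf n} \<and> t < 1 / b (lv x)" if "x \<in> E" for x
      using that assms(2) by (auto simp: E_def test_fun_def split: if_splits)
    have fin: "finite (lv ` E)"
    proof (rule finite_subset)
      show "lv ` E \<subseteq> {n * n..<leaf n}" using E by blast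
    qed simp
    define j where "j = Max (lv ` E)"
    have "j \<in> lv ` E" unfolding j_def using fin False by (intro Max_in) auto
    then have j: "j \<in> {n * n..<leaf n}" "t < 1 / b j" using E by auto
    have "lv x \<le> j" if "x \<in> E" for x unfolding j_def using fin that by (intro Max_ge) auto
    then have "emeasure M E \<le> emeasure M {x \<in> X. lv x < Suc j}"
      by (intro emeasure_mono) (auto simp: E_def less_Suc_eq_le)
    also have "\<dots> \<le> ennreal (2 * K j)"
      unfolding emeasure_below using S_le_b[of j] K_ge_b[of j] by (intro ennreal_leI) (simp add: S_Suc)
    finally have "D \<le> epow (ennreal (2 * K j)) (1 / p)"
      unfolding D using p by (intro epow_mono) auto
    also have "\<dots> = ennreal (2 powr (1 / p) * b j)"
      by (simp add: epow_ennreal less_imp_le powr_mult K_root)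
    also have "\<dots> \<le> ennreal (2 * b j)"
      using powr_mono[of "1 / p" 1 "2::real"] p by (intro ennreal_leI mult_right_mono) auto
    finally show ?thesis using j by blast
  qed (simp add: D)
qed

text \<open>For finite q each of the 2n levels adds at most 2^q / q to the integral, whatever its
  height; the q-th root gives n^(1/q).\<close>

lemma lorentz_norm_test_fun:
  assumes "1 \<le> q"
  shows "\<exists>C>0. \<forall>n\<ge>1. lorentz_norm M p q (\<lambda>x. ennreal \<bar>test_fun n x\<bar>) \<le> ennreal (C * real n powr (1 / enn2real q))"
proof (cases "q = \<infinity>")
  case True
  \<comment> \<open>For q = \<infinity> the exponent \<open>1 / enn2real q\<close> is 0 by
    convention, so a constant bound is needed; n \<ge> 1 avoids \<open>0 powr 0 = 0\<close>.\<close>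
  have "ennreal t * epow (distrib_fun M (\<lambda>x. ennreal \<bar>test_fun n x\<bar>) t) (1 / p) \<le> ennreal 2" if "0 < t" for t n
    using test_fun_distrib[OF that, of n]
  proof (elim disjE bexE conjE)
    fix j
    let ?D = "epow (distrib_fun M (\<lambda>x. ennreal \<bar>test_fun n x\<bar>) t) (1 / p)"
    assume j: "t < 1 / b j" "?D \<le> ennreal (2 * b j)"
    have "ennreal t * ?D \<le> ennreal t * ennreal (2 * b j)"
      using j by (intro mult_left_mono) auto
    also have "\<dots> = ennreal (t * (2 * b j))"
      using that by (simp add: ennreal_mult[symmetric])
    also have "\<dots> \<le> ennreal 2"
      using j that by (intro ennreal_leI) (simp add: field_simps)
    finally show ?thesis .
  qed simp
  then show ?thesis
    by (intro exI[of _ 2]) (auto simp: lorentz_norm_def True intro!: SUP_least)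
next
  case False
  define r where "r = enn2real q"
  have r: "1 \<le> r"
    using assms False unfolding r_def by (cases q) (auto simp flip: ennreal_1)
  define C where "C = p powr (1 / r) * (2 * 2 powr r / r) powr (1 / r)"
  have "lorentz_norm M p q (\<lambda>x. ennreal \<bar>test_fun n x\<bar>) \<le> ennreal (C * real n powr (1 / r))" for n
  proof -
    let ?D = "\<lambda>t. epow (distrib_fun M (\<lambda>x. ennreal \<bar>test_fun n x\<bar>) t) (1 / p)"
    let ?c = "{n * n..<leaf n}"
    let ?g = "\<lambda>j t. ennreal ((2 * b j) powr r) * ennreal (indicator {0..1 / b j} t * t powr (r - 1))"
    have "(\<integral>\<^sup>+ t. indicator {0<..} t * (epow (ennreal t * ?D t) r / ennreal t) \<partial>lborel)
      \<le> (\<integral>\<^sup>+ t. (\<Sum>j\<in>?c. ?g j t) \<partial>lborel)"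
    proof (intro nn_integral_mono)
      fix t :: real
      show "indicator {0<..} t * (epow (ennreal t * ?D t) r / ennreal t) \<le> (\<Sum>j\<in>?c. ?g j t)"
      proof (cases "0 < t \<and> ?D t \<noteq> 0")
        case True
        then have t: "0 < t" by simp
        \<comment> \<open>The level j depends on t; the sum over all levels removes this
          dependence.\<close>
        obtain j where j: "j \<in> ?c" "t < 1 / b j" "?D t \<le> ennreal (2 * b j)"
          using test_fun_distrib[OF t, of n] True by auto
        have "epow (ennreal t * ?D t) r / ennreal t \<le> epow (ennreal t * ennreal (2 * b j)) r / ennreal t"
          using j r by (intro divide_right_mono_ennreal epow_mono mult_left_mono) auto
        also have "\<dots> = ennreal ((t * (2 * b j)) powr r / t)"
          using t by (simp add: ennreal_mult[symmetric] epow_ennreal divide_ennreal)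
        also have "(t * (2 * b j)) powr r / t = (2 * b j) powr r * t powr (r - 1)"
          using t by (simp add: powr_mult powr_diff)
        also have "ennreal \<dots> = ?g j t"
          using t j by (simp add: ennreal_mult[symmetric])
        also have "\<dots> \<le> (\<Sum>j\<in>?c. ?g j t)"
          using j by (intro member_le_sum) auto
        finally show ?thesis using t by simp
      qed auto
    qed
    also have "\<dots> = (\<Sum>j\<in>?c. \<integral>\<^sup>+ t. ?g j t \<partial>lborel)"
      by (rule nn_integral_sum) simp
    also have "\<dots> = (\<Sum>j\<in>?c. ennreal (2 powr r / r))"
    proof (rule sum.cong)
      fix j
      have "(\<integral>\<^sup>+ t. ?g j t \<partial>lborel) = ennreal ((2 * b j) powr r)
          * (\<integral>\<^sup>+ t. ennreal (indicator {0..1 / b j} t * t powr (r - 1)) \<partial>lborel)"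
        by (rule nn_integral_cmult) simp
      also have "(\<integral>\<^sup>+ t. ennreal (indicator {0..1 / b j} t * t powr (r - 1)) \<partial>lborel) = ennreal ((1 / b j) powr r / r)"
        using r by (intro nn_integral_powr_from_0) auto
      also have "ennreal ((2 * b j) powr r) * ennreal ((1 / b j) powr r / r) = ennreal (2 powr r / r)"
        using r by (simp add: ennreal_mult[symmetric] powr_mult powr_divide)
      finally show "(\<integral>\<^sup>+ t. ?g j t \<partial>lborel) = ennreal (2 powr r / r)" .
    qed simp
    also have "\<dots> = ennreal (real n * (2 * 2 powr r / r))"
      using r by (simp add: leaf_def ennreal_of_nat_eq_real_of_nat ennreal_mult[symmetric])
    finally have "epow (\<integral>\<^sup>+ t. indicator {0<..} t * (epow (ennreal t * ?D t) r / ennreal t) \<partial>lborel) (1 / r)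
        \<le> epow (ennreal (real n * (2 * 2 powr r / r))) (1 / r)"
      using r by (intro epow_mono) auto
    also have "\<dots> = ennreal (real n powr (1 / r) * (2 * 2 powr r / r) powr (1 / r))"
      using r by (subst epow_ennreal) (auto simp: powr_mult[symmetric])
    finally have "lorentz_norm M p q (\<lambda>x. ennreal \<bar>test_fun n x\<bar>)
        \<le> ennreal (p powr (1 / r)) * ennreal (real n powr (1 / r) * (2 * 2 powr r / r) powr (1 / r))"
      using False by (simp add: lorentz_norm_def r_def[symmetric] mult_left_mono)
    also have "\<dots> = ennreal (C * real n powr (1 / r))"
      using r by (simp add: C_def ennreal_mult[symmetric] mult_ac)
    finally show ?thesis .
  qed
  moreover have "0 < C" using p r by (simp add: C_def)
  ultimately show ?thesis unfolding r_def by blast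
qed

text \<open>In the ball formed by x and its neighbours, each of the 2n neighbours adds
  \<open>1 / b j\<close> times \<open>b j\<close>, that is 1, to the integral, and the mass is at
  most \<open>2 * b (leaf n)\<close>.\<close>

lemma centered_maximal_test_fun:
  assumes x: "x \<in> L (leaf n)"
  shows "ennreal (real n / b (leaf n)) \<le> centered_maximal X d M (test_fun n) x"
proof -
  let ?c = "{n * n..<leaf n}"
  let ?A = "insert x (nbr x)"
  define y where "y j = pt j (ix x mod R j)" for j
  have xX: "x \<in> X" and lx: "lv x = leaf n" and cx: "cmp x = n"
    using x by (auto simp: L_def cmp_def)
  have y: "y j \<in> X" "lv (y j) = j" for j
    by (simp_all add: y_def)
  have yn: "y j \<in> nbr x" if "j \<in> ?c" for j
  proof -
    have "floor_sqrt j = n"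
      using that le_floor_sqrt_iff[of n j] floor_sqrt_le_iff_leaf[of j n]
      by (intro antisym) (auto simp: power2_eq_square)
    then show ?thesis
      using that lx cx y[of j] unfolding nbr_def parent_def by (simp add: cmp_def) (simp add: y_def)
  qed
  have "ennreal (2 * real n) = (\<Sum>j\<in>?c. ennreal (1 / b j) * emeasure M {y j})"
  proof -
    have "ennreal (1 / b j) * emeasure M {y j} = 1" for j
      using y[of j] by (simp add: emeasure_singleton ennreal_mult[symmetric])
    then show ?thesis by (simp add: leaf_def ennreal_of_nat_eq_real_of_nat)
  qed
  also have "\<dots> = (\<integral>\<^sup>+z. (\<Sum>j\<in>?c. ennreal (1 / b j) * indicator {y j} z) \<partial>M)"
    using y by (subst nn_integral_sum) (auto simp: nn_integral_cmult_indicator)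
  also have "\<dots> \<le> (\<integral>\<^sup>+z\<in>?A. ennreal \<bar>test_fun n z\<bar> \<partial>M)"
  proof (intro nn_integral_mono)
    fix z
    show "(\<Sum>j\<in>?c. ennreal (1 / b j) * indicator {y j} z) \<le> ennreal \<bar>test_fun n z\<bar> * indicator ?A z"
    proof (cases "z \<in> y ` ?c")
      case True
      then obtain i where i: "i \<in> ?c" "z = y i" by blast
      have "(\<Sum>j\<in>?c. ennreal (1 / b j) * indicator {y j} z) = (\<Sum>j\<in>?c. if j = i then ennreal (1 / b j) else 0)"
        using y i by (intro sum.cong) (auto simp: indicator_def, metis)
      also have "\<dots> = ennreal \<bar>test_fun n z\<bar> * indicator ?A z"
        using i y[of i] yn[OF i(1)] by (simp add: test_fun_def)
      finally show ?thesis by simp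
    next
      case False
      then have "(\<Sum>j\<in>?c. ennreal (1 / b j) * indicator {y j} z) = 0"
        by (intro sum.neutral) (auto simp: indicator_def)
      then show ?thesis by simp
    qed
  qed
  finally have num: "ennreal (2 * real n) \<le> \<dots>" .
  have "?A \<subseteq> {x} \<union> {z \<in> X. lv z < leaf n}"
    using lx cx by (auto simp: nbr_def parent_def)
  then have "emeasure M ?A \<le> emeasure M {x} + emeasure M {z \<in> X. lv z < leaf n}"
    using xX by (intro order_trans[OF emeasure_mono emeasure_subadditive]) auto
  also have "\<dots> = ennreal (b (leaf n) + S (leaf n))"
    using xX lx by (simp add: emeasure_singleton emeasure_below)
  also have "\<dots> \<le> ennreal (2 * b (leaf n))"
    using S_le_b[of "leaf n"] by (intro ennreal_leI) simp
  finally have den: "emeasure M ?A \<le> ennreal (2 * b (leaf n))" .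
  have "ennreal (real n / b (leaf n)) = ennreal (2 * real n) / ennreal (2 * b (leaf n))"
    by (subst divide_ennreal) auto
  also have "\<dots> \<le> (\<integral>\<^sup>+z\<in>?A. ennreal \<bar>test_fun n z\<bar> \<partial>M) / emeasure M ?A"
    using num den by (rule divide_mono_ennreal)
  also have "\<dots> \<le> centered_maximal X d M (test_fun n) x"
    unfolding centered_maximal_def mball_nbr[OF xX, symmetric] by (intro SUP_upper) auto
  finally show ?thesis .
qed

lemma lorentz_norm_centered_maximal_test_fun:
  assumes "1 \<le> r"
  shows "\<exists>c>0. \<forall>n. ennreal (c * real n) \<le> lorentz_norm M p r (centered_maximal X d M (test_fun n))"
proof -
  obtain c where c: "0 < c" and low: "\<And>h a B. 0 \<le> a \<Longrightarrow> 0 \<le> B \<Longrightarrow>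
      (\<And>t. 0 < t \<Longrightarrow> t < a \<Longrightarrow> ennreal B \<le> epow (distrib_fun M h t) (1 / p)) \<Longrightarrow>
      ennreal (c * (a * B)) \<le> lorentz_norm M p r h"
    using lorentz_norm_lower[of p r M] p assms by auto
  \<comment> \<open>The maximal function has height n / \<open>b (leaf n)\<close> on the last level,
    whose mass has (1/p)-th power \<open>b (leaf n)\<close>.\<close>
  have "ennreal (c * (real n / b (leaf n) * b (leaf n))) \<le> lorentz_norm M p r (centered_maximal X d M (test_fun n))" for n
  proof (rule low)
    fix t :: real assume t: "0 < t" "t < real n / b (leaf n)"
    let ?h = "centered_maximal X d M (test_fun n)"
    have "ennreal t < ?h x" if "x \<in> L (leaf n)" for x
    proof -
      have "ennreal t < ennreal (real n / b (leaf n))"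
        using t by (intro ennreal_lessI) auto
      also have "\<dots> \<le> ?h x" by (rule centered_maximal_test_fun[OF that])
      finally show ?thesis .
    qed
    then have "L (leaf n) \<subseteq> {x \<in> space M. ennreal t < ?h x}"
      using L_subset[of "leaf n"] unfolding space_M by blast
    then have "emeasure M (L (leaf n)) \<le> distrib_fun M ?h t"
      unfolding distrib_fun_measurable[OF measurable_M] by (intro emeasure_mono) auto
    then have "epow (ennreal (K (leaf n))) (1 / p) \<le> epow (distrib_fun M ?h t) (1 / p)"
      unfolding emeasure_L using p by (intro epow_mono) auto
    then show "ennreal (b (leaf n)) \<le> epow (distrib_fun M ?h t) (1 / p)"
      by (simp add: epow_ennreal less_imp_le K_root)
  qed auto
  then show ?thesis using c by auto
qed

text \<open>A finite constant would bound n by a multiple of n^(1/q), where 1/q < 1 (read as 0 for q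
  = \<infinity>).\<close>

lemma max_const_infinite:
  assumes "1 < q" "1 \<le> r"
  shows "max_const p q r X d M = \<infinity>"
proof -
  define \<theta> where "\<theta> = 1 / enn2real q"
  have \<theta>: "\<theta> < 1"
    using assms(1) unfolding \<theta>_def by (cases q) (auto simp: ennreal_less_iff simp flip: ennreal_1)
  obtain c where c: "0 < c" "\<And>n. ennreal (c * real n) \<le> lorentz_norm M p r (centered_maximal X d M (test_fun n))"
    using lorentz_norm_centered_maximal_test_fun[OF assms(2)] by auto
  obtain C where C: "0 < C" "\<And>n. 1 \<le> n \<Longrightarrow>
      lorentz_norm M p q (\<lambda>x. ennreal \<bar>test_fun n x\<bar>) \<le> ennreal (C * real n powr \<theta>)"
    using lorentz_norm_test_fun[of q] assms(1) unfolding \<theta>_def by (auto simp: less_imp_le)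
  have "e = \<infinity>" if e: "\<forall>f \<in> lorentz_space M p q. lorentz_norm M p r (centered_maximal X d M f)
      \<le> e * lorentz_norm M p q (\<lambda>x. ennreal \<bar>f x\<bar>)" for e
  proof (rule ccontr)
    assume "e \<noteq> \<infinity>"
    then obtain e' where e': "e = ennreal e'" "0 \<le> e'" by (cases e) auto
    have bound: "real n powr (1 - \<theta>) \<le> e' * C / c" if n: "1 \<le> n" for n
    proof -
      have "test_fun n \<in> lorentz_space M p q"
        using le_less_trans[OF C(2)[OF n]] by (simp add: lorentz_space_def)
      then have "ennreal (c * real n) \<le> e * lorentz_norm M p q (\<lambda>x. ennreal \<bar>test_fun n x\<bar>)"
        using e c(2) order_trans by blast
      also have "\<dots> \<le> e * ennreal (C * real n powr \<theta>)"
        by (intro mult_left_mono C(2) n) simp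
      finally have "c * real n \<le> e' * (C * real n powr \<theta>)"
        using e' C(1) by (simp add: ennreal_mult[symmetric])
      then show ?thesis
        using n c(1) by (simp add: powr_diff field_simps)
    qed
    \<comment> \<open>Chosen so that n to the power 1 - \<theta> is at least
      \<open>e' * C / c + 1\<close>, beyond the bound.\<close>
    define n where "n = nat \<lceil>(e' * C / c + 1) powr (1 / (1 - \<theta>))\<rceil>"
    have pos: "0 < e' * C / c + 1"
      using e' C(1) c(1) by (simp add: add_nonneg_pos)
    have n: "(e' * C / c + 1) powr (1 / (1 - \<theta>)) \<le> real n"
      unfolding n_def by (rule real_nat_ceiling_ge)
    moreover have "0 < (e' * C / c + 1) powr (1 / (1 - \<theta>))" using pos by simp
    ultimately have "1 \<le> n" by linarith
    have "e' * C / c + 1 = ((e' * C / c + 1) powr (1 / (1 - \<theta>))) powr (1 - \<theta>)"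
      using \<theta> pos by (simp add: powr_powr)
    also have "\<dots> \<le> real n powr (1 - \<theta>)"
      using n \<theta> by (intro powr_mono2) auto
    finally show False using bound[OF \<open>1 \<le> n\<close>] by simp
  qed
  then show ?thesis
    unfolding max_const_def by (intro antisym Inf_greatest) auto
qed

end

theorem theorem4p3p1:
  fixes p0 :: real and q0 r0 :: ennreal
  assumes "admissible p0 q0 r0" and "1 < q0"
  shows "\<exists>(X :: real set) d M. mm_space X d M \<and> \<not> doubling X d M \<and>
           max_const p0 1 r0 X d M < \<infinity> \<and> max_const p0 q0 r0 X d M = \<infinity>"
proof -
  \<comment> \<open>As \<open>1 < q0\<close>, the branch of admissibility with p = q = 1 is
    excluded.\<close>
  have p: "1 < p0" and r: "1 \<le> r0"
    using assms by (auto simp: admissible_def)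
  interpret tower p0 "nat \<lceil>2 * p0\<^sup>2\<rceil>"
    by unfold_locales (use p real_nat_ceiling_ge in auto)
  show ?thesis
    using mm_space_tower not_doubling_tower max_const_finite[OF r] max_const_infinite[OF assms(2) r]
    by blast
qed

end
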